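(* Let $\tilde f:\mathbb{R}^2\to\mathbb{R}^2$ be a homeomorphism isotopic to the identity, commuting with $T(x,y)=(x+1,y)$, and satisfying hypotheses (H1), (H2), (H3). Let $\tilde A=\tilde A_0\cup\tilde A_1$. Then $0\in\rho_{\Theta(\tilde A)}(\tilde f)$.
   Context: Let $\tilde f$ be a homeomorphism of $\mathbb{R}^2$ isotopic to the identity and commuting with $T(x,y)=(x+1,y)$; $p_1$ is the first coordinate projection. For a horizontal line $\Gamma$, $U^+_\Gamma$ and $U^-_\Gamma$ denote the open half-planes above and below $\Gamma$. Hypotheses: (H1) $\Gamma_0,\Gamma_1,\Gamma_2$ are horizontal lines with $\Gamma_0\subset U^+_{\Gamma_1}$, $\Gamma_1\subset U^+_{\Gamma_2}$, and $\tilde f(\Gamma_j)\subset U^-_{\Gamma_j}$ for $j=0,1,2$; (H2) $\tilde f^n(\Gamma_0)\cap\Gamma_2\ne\emptyset$ for every integer $n\ge1$; (H3) for $i\in\{0,1\}$, letting $\tilde A_i$ be the closed band between $\Gamma_i$ and $\Gamma_{i+1}$, the sets $\Theta(\tilde A_0),\Theta(\tilde A_1)$ are non-empty and $\rho_{\Theta(\tilde A_0)}(\tilde f)\subset(0,+\infty)$, $\rho_{\Theta(\tilde A_1)}(\tilde f)\subset(-\infty,0)$. Here $\Theta(\tilde E)=\{x\in\tilde E:\tilde f^n(x)\in\tilde E\ \forall n\in\mathbb{Z}\}$, and for a closed $T$-invariant set $\tilde E$ contained in a horizontal band, $\rho_{\tilde E}(\tilde f)=\bigcap_{m\ge1}\mathrm{Cl}\big(\bigcup_{n\ge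 m}\{\frac1n(p_1(\tilde f^n(\tilde z))-p_1(\tilde z)): \tilde z\in\tilde E,\ \tilde f^n(\tilde z)\in\tilde E\}\big)$, closure in $\overline{\mathbb{R}}=\mathbb{R}\cup\{\pm\infty\}$. *)

theory Defs
  imports "HOL-Analysis.Analysis" "HOL-Library.Extended_Real"
begin

definition Tshift :: "real \<times> real \<Rightarrow> real \<times> real" where
  "Tshift z = (fst z + 1, snd z)"

definition isotopic_to_id :: "(real \<times> real \<Rightarrow> real \<times> real) \<Rightarrow> bool" where
  "isotopic_to_id f \<longleftrightarrow>
     (\<exists>H :: real \<times> (real \<times> real) \<Rightarrow> real \<times> real.
        continuous_on ({0..1} \<times> UNIV) H \<and>
        (\<forall>z. H (0, z) = z) \<and> (\<forall>z. H (1, z) = f z) \<and>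
        (\<forall>t\<in>{0..1}. \<exists>g. homeomorphism UNIV UNIV (\<lambda>z. H (t, z)) g))"

definition hline :: "real \<Rightarrow> (real \<times> real) set" where
  "hline c = {z. snd z = c}"
definition Uplus :: "real \<Rightarrow> (real \<times> real) set" where
  "Uplus c = {z. snd z > c}"
definition Uminus :: "real \<Rightarrow> (real \<times> real) set" where
  "Uminus c = {z. snd z < c}"

definition band :: "real \<Rightarrow> real \<Rightarrow> (real \<times> real) set" where
  "band b a = {z. b \<le> snd z \<and> snd z \<le> a}"

definition ipow :: "('a \<Rightarrow> 'a) \<Rightarrow> ('a \<Rightarrow> 'a) \<Rightarrow> int \<Rightarrow> 'a \<Rightarrow> 'a" where
  "ipow f g n = (if 0 \<le> n then f ^^ nat n else g ^^ nat (- n))"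

definition Theta :: "('a \<Rightarrow> 'a) \<Rightarrow> ('a \<Rightarrow> 'a) \<Rightarrow> 'a set \<Rightarrow> 'a set" where
  "Theta f g E = {x \<in> E. \<forall>n::int. ipow f g n x \<in> E}"

definition rot_set :: "(real \<times> real \<Rightarrow> real \<times> real) \<Rightarrow> (real \<times> real) set \<Rightarrow> ereal set" where
  "rot_set f E = (\<Inter>m\<in>{1::nat..}. closure (\<Union>n\<in>{m..}.
      {ereal ((fst ((f ^^ n) z) - fst z) / real n) | z. z \<in> E \<and> (f ^^ n) z \<in> E}))"

end

theory Submission
  imports Defs
begin

text \<open>It suffices to find an orbit of \<open>\<Theta>(A)\<close> that runs from the upper band to the lower one: if \<open>0\<close> were
  not in the rotation set, all long displacements along this orbit would have the same sign, while
  its two limit sets lie in \<open>\<Theta>(A0)\<close> and \<open>\<Theta>(A1)\<close>, where the displacements have opposite signs.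

  If no such orbit exists, then by compactness, for some \<open>n\<close>, the sets \<open>f^n(U-(\<Gamma>0))\<close> and
  \<open>f^-n(U+(\<Gamma>2))\<close> are disjoint along \<open>\<Gamma>1\<close>. Inside them choose a path \<open>\<delta>\<close> from a point of \<open>\<Theta>(A0)\<close>
  down to \<open>\<Gamma>1\<close> and a path \<open>\<sigma>\<close> from a point of \<open>\<Theta>(A1)\<close> up to \<open>\<Gamma>1\<close>. All forward images of \<open>\<delta>\<close> miss
  \<open>\<sigma>\<close>, the path \<open>f^n \<circ> \<delta>\<close> ends below \<open>\<Gamma>2\<close> and \<open>f^-n \<circ> \<sigma>\<close> ends above \<open>\<Gamma>0\<close>. For large \<open>N\<close> the
  pair \<open>(f^n \<circ> \<delta>, f^-(N+n) \<circ> \<sigma>)\<close> has \<open>\<delta>\<close> passing to the left of the start of \<open>\<sigma>\<close>, whereas its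
  image under \<open>f^N\<close> has the start of \<open>\<delta>\<close> to the right of \<open>\<sigma>\<close>. These two configurations turn in
  opposite directions, which an isotopy from the identity to \<open>f^N\<close> forbids.\<close>

section \<open>Continuous angles of planar vectors, and the turning of a pair of paths\<close>

text \<open>The image of \<open>A\<close> is connected and misses the zeros of the sine, so it stays
  between two neighbouring zeros. Tracking the integer \<open>k\<close> makes it possible to compare
  angles along successive arcs.\<close>

lemma sin_pos_branch:
  fixes A :: "'a::topological_space \<Rightarrow> real"
  assumes "connected S" "continuous_on S A" and pos: "\<And>x. x \<in> S \<Longrightarrow> sin (A x) > 0"
  obtains k :: int where "\<And>x. x \<in> S \<Longrightarrow> 2 * pi * k < A x \<and> A x < 2 * pi * k + pi"
proof (cases "S = {}")
  case True
  then show ?thesis using that by blast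
next
  case False
  then obtain x0 where x0: "x0 \<in> S" by blast
  define k where "k = \<lfloor>A x0 / (2 * pi)\<rfloor>"
  have per: "sin (y - 2 * pi * k) = sin y" for y :: real
    using sin_int_2pin [of k] cos_int_2pin [of k] by (simp add: sin_diff)
  have lo: "2 * pi * k \<le> A x0"
    using floor_divide_lower [of "2 * pi" "A x0"] by (simp add: k_def mult.commute)
  have hi: "A x0 < 2 * pi * k + 2 * pi"
    using floor_divide_upper [of "2 * pi" "A x0"] by (simp add: k_def algebra_simps)
  have hi': "A x0 < 2 * pi * k + pi"
    using sin_le_zero [of "A x0 - 2 * pi * k"] hi pos [OF x0] per [of "A x0"] by force
  have conn: "connected (A ` S)"
    using assms connected_continuous_image by blast
  have "sin (2 * pi * k) = 0" "sin (2 * pi * k + pi) = 0"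
    using per [of "2 * pi * k"] per [of "2 * pi * k + pi"] by (simp_all del: sin_int_2pin)
  then have avoid: "2 * pi * k \<notin> A ` S" "2 * pi * k + pi \<notin> A ` S"
    using pos by (metis imageE less_irrefl)+
  have "2 * pi * k < A x \<and> A x < 2 * pi * k + pi" if "x \<in> S" for x
  proof -
    have *: "A x \<in> A ` S" "A x0 \<in> A ` S"
      using that x0 by auto
    have "2 * pi * k < A x"
      using connectedD_interval [OF conn *, of "2 * pi * k"] avoid lo by force
    moreover have "A x < 2 * pi * k + pi"
      using connectedD_interval [OF conn *(2,1), of "2 * pi * k + pi"] avoid hi' by force
    ultimately show ?thesis by blast
  qed
  then show ?thesis using that by blast
qed

text \<open>A convex set is contractible, so the field, read as a nowhere zero complex function, has
  a continuous logarithm; its imaginary part is the angle.\<close>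

lemma continuous_polar:
  fixes V :: "'a::real_normed_vector \<Rightarrow> real \<times> real"
  assumes "continuous_on S V" "convex S" and nz: "\<And>x. x \<in> S \<Longrightarrow> V x \<noteq> 0"
  obtains R A :: "'a \<Rightarrow> real" where "continuous_on S A"
    "\<And>x. x \<in> S \<Longrightarrow> R x > 0 \<and> V x = (R x * cos (A x), R x * sin (A x))"
proof -
  have "continuous_on S (\<lambda>x. Complex (fst (V x)) (snd (V x)))"
    using assms(1) by (intro continuous_intros)
  moreover have "Complex (fst (V x)) (snd (V x)) \<noteq> 0" if "x \<in> S" for x
    using nz [OF that] by (auto simp: complex_eq_iff prod_eq_iff)
  ultimately obtain L where L: "continuous_on S L"
      "\<And>x. x \<in> S \<Longrightarrow> Complex (fst (V x)) (snd (V x)) = exp (L x)"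
    using continuous_logarithm_on_contractible [OF _ convex_imp_contractible [OF \<open>convex S\<close>]]
    by blast
  show ?thesis
  proof (rule that [of "\<lambda>x. Im (L x)" "\<lambda>x. exp (Re (L x))"])
    show "continuous_on S (\<lambda>x. Im (L x))"
      using L(1) by (intro continuous_intros)
    show "exp (Re (L x)) > 0 \<and>
        V x = (exp (Re (L x)) * cos (Im (L x)), exp (Re (L x)) * sin (Im (L x)))" if "x \<in> S" for x
      using L(2) [OF that] by (auto simp: complex_eq_iff Re_exp Im_exp prod_eq_iff)
  qed
qed

text \<open>Two polar forms of equal (\<open>e = 1\<close>) or opposite (\<open>e = -1\<close>)
  vectors have the same modulus, so only the angles can differ. This compares angle functions that
  were chosen independently of each other.\<close>

lemma cos_angle_diff:
  fixes r q x y e :: real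
  assumes "r > 0" "q > 0" "r * cos x = e * (q * cos y)" "r * sin x = e * (q * sin y)" "\<bar>e\<bar> = 1"
  shows "cos (x - y) = e"
proof -
  have "r\<^sup>2 = (r * cos x)\<^sup>2 + (r * sin x)\<^sup>2"
    by (simp add: power_mult_distrib flip: distrib_left)
  also have "\<dots> = e\<^sup>2 * (q\<^sup>2 * ((cos y)\<^sup>2 + (sin y)\<^sup>2))"
    unfolding assms(3,4) by (simp only: power_mult_distrib distrib_left)
  also have "\<dots> = q\<^sup>2"
    using assms(5) by (simp flip: power2_abs [of e])
  finally have "r = q"
    using assms(1,2) by (simp add: power2_eq_iff)
  then have *: "cos x = e * cos y" "sin x = e * sin y"
    using assms(1-4) by (simp_all add: mult.left_commute)
  have "cos (x - y) = e * ((cos y)\<^sup>2 + (sin y)\<^sup>2)"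
    unfolding cos_diff * by (simp only: power2_eq_square distrib_left mult.assoc)
  then show ?thesis by simp
qed

text \<open>Follow the angle of \<open>H u \<circ> \<alpha> - H u \<circ> \<beta>\<close> backwards from time \<open>1\<close> to \<open>0\<close>, and then that of
  \<open>H u (\<delta> t) - H u (\<sigma> s)\<close> from \<open>(t, s) = (0, 0)\<close> to \<open>(1, 1)\<close>: this leads from a vector to its opposite.
  The total variation is therefore an odd multiple of \<open>\<pi>\<close> and independent of \<open>u\<close>; but the
  hypotheses make it \<open>\<pi>\<close> for \<open>u = 0\<close> and \<open>-\<pi>\<close> for \<open>u = 1\<close>.\<close>

lemma isotopy_preserves_turning_side:
  fixes F :: "real \<times> real \<Rightarrow> real \<times> real" and \<alpha> \<beta> \<delta> \<sigma> :: "real \<Rightarrow> real \<times> real"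
  assumes iso: "isotopic_to_id F"
    and cont: "continuous_on {0..1} \<delta>" "continuous_on {0..1} \<sigma>"
      "continuous_on {0..1} \<alpha>" "continuous_on {0..1} \<beta>"
    and ends: "\<alpha> 0 = \<delta> 0" "\<beta> 0 = \<sigma> 0" "\<alpha> 1 = \<sigma> 1" "\<beta> 1 = \<delta> 1"
    and disj: "\<And>t s. t \<in> {0..1} \<Longrightarrow> s \<in> {0..1} \<Longrightarrow> \<delta> t \<noteq> \<sigma> s"
    and up0: "\<And>r. r \<in> {0..1} \<Longrightarrow> snd (\<beta> r) < snd (\<alpha> r)"
    and up1: "\<And>r. r \<in> {0..1} \<Longrightarrow> snd (F (\<beta> r)) < snd (F (\<alpha> r))"
    and left0: "\<And>t. t \<in> {0..1} \<Longrightarrow> fst (\<delta> t) < fst (\<sigma> 0)"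
    and low0: "\<And>s. s \<in> {0..1} \<Longrightarrow> snd (\<delta> 1) < snd (\<sigma> s)"
    and right1: "\<And>s. s \<in> {0..1} \<Longrightarrow> fst (F (\<sigma> s)) < fst (F (\<delta> 0))"
    and low1: "\<And>t. t \<in> {0..1} \<Longrightarrow> snd (F (\<delta> t)) < snd (F (\<sigma> 1))"
  shows False
proof -
  obtain H :: "real \<times> (real \<times> real) \<Rightarrow> real \<times> real" where
    H: "continuous_on ({0..1} \<times> UNIV) H" "\<And>z. H (0, z) = z" "\<And>z. H (1, z) = F z"
    and Hh: "\<And>t. t \<in> {0..1} \<Longrightarrow> \<exists>g. homeomorphism UNIV UNIV (\<lambda>z. H (t, z)) g"
    using iso unfolding isotopic_to_id_def by blast
  have inj: "H (u, a) = H (u, b) \<longleftrightarrow> a = b" if "u \<in> {0..1}" for u a b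
    using Hh [OF that] unfolding homeomorphism_def by (metis UNIV_I)
  \<comment> \<open>\<open>W\<close> agrees with \<open>V\<close> at the start, \<open>r = 0\<close>
    and \<open>(t, s) = (0, 0)\<close>, and is its negative at the end, because
    \<open>\<alpha>\<close> ends on \<open>\<sigma>\<close> and \<open>\<beta>\<close> on
    \<open>\<delta>\<close>.\<close>
  define V where "V = (\<lambda>(u, t, s). H (u, \<delta> t) - H (u, \<sigma> s))"
  define W where "W = (\<lambda>(u, r). H (u, \<alpha> r) - H (u, \<beta> r))"
  let ?I = "{0..1::real}"
  have cV: "continuous_on (?I \<times> ?I \<times> ?I) V"
    unfolding V_def case_prod_unfold
    by (intro continuous_on_diff continuous_on_compose2 [OF H(1)] continuous_on_compose2 [OF cont(1)]
        continuous_on_compose2 [OF cont(2)] continuous_intros) auto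
  have nzV: "V x \<noteq> 0" if xI: "x \<in> ?I \<times> ?I \<times> ?I" for x
  proof -
    obtain u t s where x: "x = (u, t, s)" "u \<in> ?I" "t \<in> ?I" "s \<in> ?I"
      using xI by blast
    then show ?thesis
      using inj disj by (simp only: V_def case_prod_conv right_minus_eq not_False_eq_True)
  qed
  have convexV: "convex (?I \<times> ?I \<times> ?I)"
    by (intro convex_Times convex_real_interval)
  obtain RA A where contA: "continuous_on (?I \<times> ?I \<times> ?I) A" and
    A: "\<And>x. x \<in> ?I \<times> ?I \<times> ?I \<Longrightarrow> RA x > 0 \<and> V x = (RA x * cos (A x), RA x * sin (A x))"
    by (rule continuous_polar [OF cV convexV nzV]) (assumption, rule that, assumption+)
  have cW: "continuous_on (?I \<times> ?I) W"
    unfolding W_def case_prod_unfold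
    by (intro continuous_on_diff continuous_on_compose2 [OF H(1)] continuous_on_compose2 [OF cont(3)]
        continuous_on_compose2 [OF cont(4)] continuous_intros) auto
  have nzW: "W x \<noteq> 0" if xI: "x \<in> ?I \<times> ?I" for x
  proof -
    obtain u r where x: "x = (u, r)" "u \<in> ?I" "r \<in> ?I"
      using xI by blast
    then have "\<alpha> r \<noteq> \<beta> r"
      using up0 by fastforce
    with x show ?thesis
      using inj by (simp only: W_def case_prod_conv right_minus_eq not_False_eq_True)
  qed
  have convexW: "convex (?I \<times> ?I)"
    by (intro convex_Times convex_real_interval)
  obtain RB B where contB: "continuous_on (?I \<times> ?I) B" and
    B: "\<And>x. x \<in> ?I \<times> ?I \<Longrightarrow> RB x > 0 \<and> W x = (RB x * cos (B x), RB x * sin (B x))"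
    by (rule continuous_polar [OF cW convexW nzW]) (assumption, rule that, assumption+)
  have A': "RA (u,t,s) > 0" "fst (H (u, \<delta> t)) - fst (H (u, \<sigma> s)) = RA (u,t,s) * cos (A (u,t,s))"
    "snd (H (u, \<delta> t)) - snd (H (u, \<sigma> s)) = RA (u,t,s) * sin (A (u,t,s))"
    if "u \<in> ?I" "t \<in> ?I" "s \<in> ?I" for u t s
    using A [of "(u,t,s)"] that by (auto simp: V_def prod_eq_iff)
  have B': "RB (u,r) > 0" "fst (H (u, \<alpha> r)) - fst (H (u, \<beta> r)) = RB (u,r) * cos (B (u,r))"
    "snd (H (u, \<alpha> r)) - snd (H (u, \<beta> r)) = RB (u,r) * sin (B (u,r))"
    if "u \<in> ?I" "r \<in> ?I" for u r
    using B [of "(u,r)"] that by (auto simp: W_def prod_eq_iff)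
  have contAt: "continuous_on ?I (\<lambda>t. A (u, t, s))" "continuous_on ?I (\<lambda>t. A (u, s, t))"
    "continuous_on ?I (\<lambda>t. A (t, u, s))" if "u \<in> ?I" "s \<in> ?I" for u s
    by (rule continuous_on_compose2 [OF contA]; use that in \<open>auto intro!: continuous_intros\<close>)+
  have contBt: "continuous_on ?I (\<lambda>t. B (u, t))" "continuous_on ?I (\<lambda>t. B (t, u))" if "u \<in> ?I" for u
    by (rule continuous_on_compose2 [OF contB]; use that in \<open>auto intro!: continuous_intros\<close>)+
  have conn: "connected ?I" by simp
  have sgnA: "sin (A (u,t,s)) > 0 \<longleftrightarrow> snd (H (u, \<sigma> s)) < snd (H (u, \<delta> t))"
    "sin (A (u,t,s)) < 0 \<longleftrightarrow> snd (H (u, \<delta> t)) < snd (H (u, \<sigma> s))"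
    "cos (A (u,t,s)) > 0 \<longleftrightarrow> fst (H (u, \<sigma> s)) < fst (H (u, \<delta> t))"
    "cos (A (u,t,s)) < 0 \<longleftrightarrow> fst (H (u, \<delta> t)) < fst (H (u, \<sigma> s))"
    if "u \<in> ?I" "t \<in> ?I" "s \<in> ?I" for u t s
    using A' [OF that] zero_less_mult_iff [of "RA (u,t,s)"] mult_less_0_iff [of "RA (u,t,s)"]
    by (smt (verit))+
  have sgnB: "sin (B (u,r)) > 0 \<longleftrightarrow> snd (H (u, \<beta> r)) < snd (H (u, \<alpha> r))"
    if "u \<in> ?I" "r \<in> ?I" for u r
    using B' [OF that] zero_less_mult_iff [of "RB (u,r)"] by (smt (verit))

  \<comment> \<open>For \<open>u = 0\<close> and \<open>u = 1\<close> the angle \<open>B\<close>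
    stays in an interval of length pi, so it varies by less than pi.\<close>
  obtain k4 where k4: "\<And>r. r \<in> ?I \<Longrightarrow> 2 * pi * of_int k4 < B (0,r) \<and> B (0,r) < 2 * pi * of_int k4 + pi"
    by (rule sin_pos_branch [OF conn contBt(1) [of 0]]) (use sgnB up0 H in auto)
  obtain k5 where k5: "\<And>r. r \<in> ?I \<Longrightarrow> 2 * pi * of_int k5 < B (1,r) \<and> B (1,r) < 2 * pi * of_int k5 + pi"
    by (rule sin_pos_branch [OF conn contBt(1) [of 1]]) (use sgnB up1 H in auto)

  \<comment> \<open>Go from (0, 0) to (1, 1) through (1, 0). Modulo one common multiple of 2 pi, the
    angle starts in (0, pi), stays in (pi/2, 3 pi/2) on the first side and in (pi, 2 pi) on the
    second. The overlaps at the corners force the three integers to agree.\<close>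
  have A0: "0 < A (0,1,1) - A (0,0,0)" "A (0,1,1) - A (0,0,0) < 2 * pi"
  proof -
    obtain k1 where k1: "\<And>t. t \<in> ?I \<Longrightarrow> 2 * pi * of_int k1 < A (0,t,0) - pi/2 \<and> A (0,t,0) - pi/2 < 2 * pi * of_int k1 + pi"
      by (rule sin_pos_branch [of ?I "\<lambda>t. A (0,t,0) - pi/2"])
        (use sgnA left0 H contAt in \<open>auto simp: sin_diff intro!: continuous_intros\<close>)
    obtain k2 where k2: "\<And>t. t \<in> ?I \<Longrightarrow> 2 * pi * of_int k2 < A (0,1,t) - pi \<and> A (0,1,t) - pi < 2 * pi * of_int k2 + pi"
      by (rule sin_pos_branch [of ?I "\<lambda>t. A (0,1,t) - pi"])
        (use sgnA low0 H contAt in \<open>auto simp: sin_diff intro!: continuous_intros\<close>)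
    obtain k3 where k3: "\<And>x. x \<in> {(0,0,0)} \<Longrightarrow> 2 * pi * of_int k3 < A x \<and> A x < 2 * pi * of_int k3 + pi"
      by (rule sin_pos_branch [of "{(0,0,0)}" A]) (use sgnA up0 [of 0] ends H in auto)
    have "2 * pi * (real_of_int (k1 - k2)) < 2 * pi * 1" "2 * pi * (real_of_int (k2 - k1)) < 2 * pi * 1"
      using k1 [of 1] k2 [of 0] pi_gt_zero by (auto simp: algebra_simps)
    then have 12: "k1 = k2" by auto
    have "2 * pi * (real_of_int (k1 - k3)) < 2 * pi * 1" "2 * pi * (real_of_int (k3 - k1)) < 2 * pi * 1"
      using k1 [of 0] k3 [of "(0,0,0)"] pi_gt_zero by (auto simp: algebra_simps)
    then have 13: "k1 = k3" by auto
    show "0 < A (0,1,1) - A (0,0,0)" "A (0,1,1) - A (0,0,0) < 2 * pi"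
      using k2 [of 1] k3 [of "(0,0,0)"] 12 13 by auto
  qed
  \<comment> \<open>Now go through (0, 1): the angle starts in (0, pi), stays in (-pi/2, pi/2) on
    the first side and in (-pi, 0) on the second, so the turn has the other sign.\<close>
  have A1: "- 2 * pi < A (1,1,1) - A (1,0,0)" "A (1,1,1) - A (1,0,0) < 0"
  proof -
    obtain k1 where k1: "\<And>t. t \<in> ?I \<Longrightarrow> 2 * pi * of_int k1 < A (1,0,t) + pi/2 \<and> A (1,0,t) + pi/2 < 2 * pi * of_int k1 + pi"
      by (rule sin_pos_branch [of ?I "\<lambda>t. A (1,0,t) + pi/2"])
        (use sgnA right1 H contAt in \<open>auto simp: sin_add intro!: continuous_intros\<close>)
    obtain k2 where k2: "\<And>t. t \<in> ?I \<Longrightarrow> 2 * pi * of_int k2 < A (1,t,1) + pi \<and> A (1,t,1) + pi < 2 * pi * of_int k2 + pi"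
      by (rule sin_pos_branch [of ?I "\<lambda>t. A (1,t,1) + pi"])
        (use sgnA low1 H contAt in \<open>auto simp: sin_add intro!: continuous_intros\<close>)
    obtain k3 where k3: "\<And>x. x \<in> {(1,0,0)} \<Longrightarrow> 2 * pi * of_int k3 < A x \<and> A x < 2 * pi * of_int k3 + pi"
      by (rule sin_pos_branch [of "{(1,0,0)}" A]) (use sgnA up1 [of 0] ends H in auto)
    have "2 * pi * (real_of_int (k1 - k2)) < 2 * pi * 1" "2 * pi * (real_of_int (k2 - k1)) < 2 * pi * 1"
      using k1 [of 1] k2 [of 0] pi_gt_zero by (auto simp: algebra_simps)
    then have 12: "k1 = k2" by auto
    have "2 * pi * (real_of_int (k1 - k3)) < 2 * pi * 1" "2 * pi * (real_of_int (k3 - k1)) < 2 * pi * 1"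
      using k1 [of 0] k3 [of "(1,0,0)"] pi_gt_zero by (auto simp: algebra_simps)
    then have 13: "k1 = k3" by auto
    show "- 2 * pi < A (1,1,1) - A (1,0,0)" "A (1,1,1) - A (1,0,0) < 0"
      using k2 [of 1] k3 [of "(1,0,0)"] 12 13 by auto
  qed

  \<comment> \<open>\<open>E u\<close> is the negative of the total variation described above the
    lemma.\<close>
  define E where "E u = (B (u,1) - A (u,1,1)) - (B (u,0) - A (u,0,0))" for u
  have contE: "continuous_on ?I E"
    unfolding E_def by (intro continuous_intros contAt contBt) auto
  have cosE: "cos (E u) = -1" if u: "u \<in> ?I" for u
  proof -
    have 1: "cos (B (u,1) - A (u,1,1)) = -1"
    proof (rule cos_angle_diff)
      show "0 < RB (u,1)" "0 < RA (u,1,1)" using A' [of u 1 1] B' [of u 1] u by auto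
      show "RB (u,1) * cos (B (u,1)) = -1 * (RA (u,1,1) * cos (A (u,1,1)))"
        "RB (u,1) * sin (B (u,1)) = -1 * (RA (u,1,1) * sin (A (u,1,1)))"
        using A' [of u 1 1] B' [of u 1] u ends by auto
    qed simp
    have 0: "cos (B (u,0) - A (u,0,0)) = 1"
    proof (rule cos_angle_diff)
      show "0 < RB (u,0)" "0 < RA (u,0,0)" using A' [of u 0 0] B' [of u 0] u by auto
      show "RB (u,0) * cos (B (u,0)) = 1 * (RA (u,0,0) * cos (A (u,0,0)))"
        "RB (u,0) * sin (B (u,0)) = 1 * (RA (u,0,0) * sin (A (u,0,0)))"
        using A' [of u 0 0] B' [of u 0] u ends by auto
    qed simp
    then have "sin (B (u,0) - A (u,0,0)) = 0"
      by (rule cos_one_sin_zero)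
    with 0 1 show ?thesis
      unfolding E_def by (subst cos_diff) simp
  qed
  have cos_gt: "cos x \<noteq> -1" if "\<bar>x\<bar> < pi" for x
  proof -
    have "cos pi < cos \<bar>x\<bar>"
      using that by (intro cos_monotone_0_pi) auto
    then show ?thesis by simp
  qed
  \<comment> \<open>The bounds place \<open>E 0\<close> in (-3 pi, pi) and \<open>E 1\<close> in
    (-pi, 3 pi). The wrong sign would put either value in (-pi, pi), where the cosine is never
    -1.\<close>
  have "E 0 < 0"
  proof (rule ccontr)
    assume "\<not> E 0 < 0"
    then show False
      using cosE [of 0] cos_gt [of "E 0"] k4 [of 0] k4 [of 1] A0 by (force simp: E_def)
  qed
  moreover have "E 1 > 0"
  proof (rule ccontr)
    assume "\<not> E 1 > 0"
    then show False
      using cosE [of 1] cos_gt [of "E 1"] k5 [of 0] k5 [of 1] A1 by (force simp: E_def)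
  qed
  ultimately obtain u where "0 \<le> u" "u \<le> 1" "E u = 0"
    using IVT' [of E 0 0 1] contE by auto
  then show False
    using cosE [of u] by simp
qed

section \<open>Isotopies of iterates, and paths cut at a frontier\<close>

lemma isotopic_to_id_compose:
  assumes "isotopic_to_id f" "isotopic_to_id h"
  shows "isotopic_to_id (h \<circ> f)"
proof -
  obtain F where F: "continuous_on ({0..1} \<times> UNIV) F" "\<And>z. F (0, z) = z" "\<And>z. F (1, z) = f z"
    and Fh: "\<And>t. t \<in> {0..1::real} \<Longrightarrow> \<exists>g. homeomorphism UNIV UNIV (\<lambda>z. F (t, z)) g"
    using assms(1) unfolding isotopic_to_id_def by blast
  obtain H where H: "continuous_on ({0..1} \<times> UNIV) H" "\<And>z. H (0, z) = z" "\<And>z. H (1, z) = h z"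
    and Hh: "\<And>t. t \<in> {0..1::real} \<Longrightarrow> \<exists>g. homeomorphism UNIV UNIV (\<lambda>z. H (t, z)) g"
    using assms(2) unfolding isotopic_to_id_def by blast
  \<comment> \<open>Both isotopies run simultaneously, so each stage is a composition of two
    homeomorphisms.\<close>
  let ?G = "\<lambda>p. H (fst p, F p)"
  have "continuous_on ({0..1} \<times> UNIV) ?G"
    by (rule continuous_on_compose2 [OF H(1)]) (auto intro!: continuous_intros F(1))
  moreover have "\<exists>g. homeomorphism UNIV UNIV (\<lambda>z. ?G (t, z)) g" if "t \<in> {0..1}" for t
    using homeomorphism_compose Fh [OF that] Hh [OF that] by (fastforce simp: o_def)
  ultimately show ?thesis
    unfolding isotopic_to_id_def using F H by (intro exI [of _ ?G]) auto
qed

lemma isotopic_to_id_funpow: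
  assumes "isotopic_to_id f"
  shows "isotopic_to_id (f ^^ n)"
proof (induction n)
  case 0
  have "homeomorphism UNIV UNIV (\<lambda>z. z) (\<lambda>z :: real \<times> real. z)"
    by (simp add: homeomorphism_def)
  then show ?case
    unfolding isotopic_to_id_def by (intro exI [of _ snd]) (auto intro!: continuous_intros)
next
  case (Suc n)
  then show ?case
    using isotopic_to_id_compose assms by (metis funpow.simps(2))
qed

lemma funpow_invariant:
  assumes "\<And>z. P z \<Longrightarrow> P (f z)" "P z"
  shows "P ((f ^^ n) z)"
  using assms by (induction n) auto

text \<open>A path in \<open>P\<close> from \<open>a\<close> to \<open>b\<close> is cut where it
  reaches the frontier of \<open>S\<close>; since \<open>S\<close> is open, the new endpoint lies
  outside \<open>S\<close>.\<close>

lemma path_to_boundary: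
  fixes P S :: "'a::real_normed_vector set"
  assumes "path_connected P" "a \<in> P" "b \<in> P" "open S" "a \<in> S" "b \<notin> S"
  obtains h where "path h" "pathstart h = a" "path_image h \<subseteq> P \<inter> closure S" "pathfinish h \<notin> S"
proof -
  obtain p where p: "path p" "path_image p \<subseteq> P" "pathstart p = a" "pathfinish p = b"
    using assms unfolding path_connected_def by blast
  have "pathstart p \<in> closure S" "pathfinish p \<notin> S"
    using assms p closure_subset by auto
  then obtain h where h: "path h" "pathstart h = pathstart p" "path_image h \<subseteq> path_image p"
      "path_image h - {pathfinish h} \<subseteq> interior S" "pathfinish h \<in> frontier S"
    using exists_path_subpath_to_frontier [OF p(1)] by blast
  have "path_image h \<subseteq> closure S"
    using h(4,5) interior_subset closure_subset unfolding frontier_def by blast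
  moreover have "pathfinish h \<notin> S"
    using h(5) \<open>open S\<close> by (simp add: frontier_def interior_open)
  ultimately show ?thesis
    using that [of h] h p by blast
qed

section \<open>Uniform displacement estimates from the rotation set\<close>

text \<open>The extended reals are compact, so mean displacements over times \<open>N m\<close>
  tending to infinity accumulate somewhere, and by definition at a point of the rotation
  set.\<close>

lemma rot_set_limit:
  fixes N :: "nat \<Rightarrow> nat"
  assumes "\<And>m. m \<le> N m" "\<And>m. Z m \<in> E" "\<And>m. (f ^^ N m) (Z m) \<in> E"
  obtains l r where "strict_mono (r :: nat \<Rightarrow> nat)" "l \<in> rot_set f E"
    "(\<lambda>k. ereal ((fst ((f ^^ N (r k)) (Z (r k))) - fst (Z (r k))) / real (N (r k)))) \<longlonglongrightarrow> l"
proof -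
  define X where "X k = ereal ((fst ((f ^^ N k) (Z k)) - fst (Z k)) / real (N k))" for k
  obtain l r where lr: "strict_mono (r :: nat \<Rightarrow> nat)" "(X \<circ> r) \<longlonglongrightarrow> l"
    using compact_complete_linorder [of X] by blast
  have "l \<in> closure (\<Union>n\<in>{m..}. {ereal ((fst ((f ^^ n) z) - fst z) / real n) | z. z \<in> E \<and> (f ^^ n) z \<in> E})"
    (is "l \<in> closure ?C") for m
  proof (rule Lim_in_closed_set [OF closed_closure _ _ lr(2)])
    have "(X \<circ> r) k \<in> ?C" if "m \<le> k" for k
    proof -
      have "m \<le> N (r k)"
        using that seq_suble [OF lr(1), of k] assms(1) [of "r k"] by linarith
      then show ?thesis
        unfolding o_def X_def using assms(2,3) [of "r k"]
        by (intro UN_I [of "N (r k)"] CollectI exI [of _ "Z (r k)"] conjI) auto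
    qed
    then show "\<forall>\<^sub>F k in sequentially. (X \<circ> r) k \<in> closure ?C"
      using closure_subset by (intro eventually_sequentiallyI [of m]) blast
  qed simp
  then have "l \<in> rot_set f E"
    unfolding rot_set_def by blast
  then show ?thesis
    using that [OF lr(1)] lr(2) by (simp add: X_def o_def)
qed

lemma tendsto_ereal_inverse_Suc: "(\<lambda>n. ereal (1 / real (Suc n))) \<longlonglongrightarrow> 0"
  using LIMSEQ_inverse_real_of_nat by (simp add: zero_ereal_def inverse_eq_divide)

text \<open>\<open>S e\<close> is a family of forbidden values with tolerance \<open>e\<close>. One
  index \<open>m\<close> controls both the minimal time and the tolerance, so failure for every
  \<open>m\<close> yields a sequence of ever longer times and ever smaller tolerances, with a limit
  in the rotation set.\<close>

lemma rot_set_avoid: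
  fixes S :: "real \<Rightarrow> real set"
  assumes "\<And>l r X. strict_mono (r :: nat \<Rightarrow> nat) \<Longrightarrow> (\<And>k. X k \<in> S (1 / real (Suc (r k)))) \<Longrightarrow>
      (\<lambda>k. ereal (X k)) \<longlonglongrightarrow> l \<Longrightarrow> l \<notin> rot_set f E"
  obtains m where "\<And>n z. m \<le> n \<Longrightarrow> z \<in> E \<Longrightarrow> (f ^^ n) z \<in> E \<Longrightarrow>
      (fst ((f ^^ n) z) - fst z) / real n \<notin> S (1 / real (Suc m))"
proof (rule ccontr)
  assume "\<not> thesis"
  then have "\<forall>m. \<exists>n z. m \<le> n \<and> z \<in> E \<and> (f ^^ n) z \<in> E \<and>
      (fst ((f ^^ n) z) - fst z) / real n \<in> S (1 / real (Suc m))"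
    using that by blast
  then obtain N where "\<forall>m. \<exists>z. m \<le> N m \<and> z \<in> E \<and> (f ^^ N m) z \<in> E \<and>
      (fst ((f ^^ N m) z) - fst z) / real (N m) \<in> S (1 / real (Suc m))"
    by (rule choice [THEN exE])
  then obtain Z where "\<forall>m. m \<le> N m \<and> Z m \<in> E \<and> (f ^^ N m) (Z m) \<in> E \<and>
      (fst ((f ^^ N m) (Z m)) - fst (Z m)) / real (N m) \<in> S (1 / real (Suc m))"
    by (rule choice [THEN exE])
  then have NZ: "\<And>m. m \<le> N m" "\<And>m. Z m \<in> E" "\<And>m. (f ^^ N m) (Z m) \<in> E"
      "\<And>m. (fst ((f ^^ N m) (Z m)) - fst (Z m)) / real (N m) \<in> S (1 / real (Suc m))"
    by blast+
  obtain l r where "strict_mono (r :: nat \<Rightarrow> nat)" "l \<in> rot_set f E"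
    "(\<lambda>k. ereal ((fst ((f ^^ N (r k)) (Z (r k))) - fst (Z (r k))) / real (N (r k)))) \<longlonglongrightarrow> l"
    by (rule rot_set_limit [OF NZ(1-3)])
  then show False
    using assms [OF _ NZ(4)] by blast
qed

text \<open>Failure of a uniform linear drift to the right would produce a nonpositive limit in the
  rotation set.\<close>

lemma rot_set_pos:
  assumes "rot_set f E \<subseteq> {0<..<\<infinity>}"
  obtains e m where "e > 0" "\<And>n z. m \<le> n \<Longrightarrow> z \<in> E \<Longrightarrow> (f ^^ n) z \<in> E \<Longrightarrow>
      e * real n \<le> fst ((f ^^ n) z) - fst z"
proof -
  obtain m where m: "\<And>n z. m \<le> n \<Longrightarrow> z \<in> E \<Longrightarrow> (f ^^ n) z \<in> E \<Longrightarrow>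
      (fst ((f ^^ n) z) - fst z) / real n \<notin> {.. 1 / real (Suc m)}"
  proof (rule rot_set_avoid [of "\<lambda>e. {..e}" f E])
    fix l r X
    assume r: "strict_mono (r :: nat \<Rightarrow> nat)" and X: "\<And>k. X k \<in> {.. 1 / real (Suc (r k))}"
      and l: "(\<lambda>k. ereal (X k)) \<longlonglongrightarrow> l"
    have "l \<le> 0"
      by (rule LIMSEQ_le [OF l LIMSEQ_subseq_LIMSEQ [OF tendsto_ereal_inverse_Suc r]])
        (use X in auto)
    then show "l \<notin> rot_set f E" using assms by force
  qed blast
  show ?thesis
  \<comment> \<open>The time threshold \<open>Suc m\<close> keeps \<open>n\<close> positive, so that
    the quotient can be cleared.\<close>
  proof (rule that [of "1 / real (Suc m)" "Suc m"])
    fix n z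
    assume *: "Suc m \<le> n" "z \<in> E" "(f ^^ n) z \<in> E"
    then show "1 / real (Suc m) * real n \<le> fst ((f ^^ n) z) - fst z"
      using m [of n z] by (simp add: not_le pos_less_divide_eq)
  qed simp
qed

lemma rot_set_neg:
  assumes "rot_set f E \<subseteq> {-\<infinity><..<0}"
  obtains e m where "e > 0" "\<And>n z. m \<le> n \<Longrightarrow> z \<in> E \<Longrightarrow> (f ^^ n) z \<in> E \<Longrightarrow>
      fst ((f ^^ n) z) - fst z \<le> - (e * real n)"
proof -
  obtain m where m: "\<And>n z. m \<le> n \<Longrightarrow> z \<in> E \<Longrightarrow> (f ^^ n) z \<in> E \<Longrightarrow>
      (fst ((f ^^ n) z) - fst z) / real n \<notin> {- (1 / real (Suc m)) ..}"
  proof (rule rot_set_avoid [of "\<lambda>e. {- e..}" f E])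
    fix l r X
    assume r: "strict_mono (r :: nat \<Rightarrow> nat)" and X: "\<And>k. X k \<in> {- (1 / real (Suc (r k))) ..}"
      and l: "(\<lambda>k. ereal (X k)) \<longlonglongrightarrow> l"
    have "- l \<le> 0"
      by (rule LIMSEQ_le [OF tendsto_uminus_ereal [OF l] LIMSEQ_subseq_LIMSEQ [OF tendsto_ereal_inverse_Suc r]])
        (use X in \<open>auto simp: minus_le_iff\<close>)
    then show "l \<notin> rot_set f E" using assms by force
  qed blast
  show ?thesis
  proof (rule that [of "1 / real (Suc m)" "Suc m"])
    fix n z
    assume *: "Suc m \<le> n" "z \<in> E" "(f ^^ n) z \<in> E"
    then have "(fst ((f ^^ n) z) - fst z) / real n < - (1 / real (Suc m))"
      using m [of n z] by simp
    then show "fst ((f ^^ n) z) - fst z \<le> - (1 / real (Suc m) * real n)"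
      using * by (simp add: pos_divide_less_eq del: of_nat_Suc)
  qed simp
qed

text \<open>Only the size of the displacement is bounded below here; its sign may depend on the
  point and on the time.\<close>

lemma rot_set_nonzero:
  assumes "0 \<notin> rot_set f E"
  obtains e m where "e > 0" "\<And>n z. m \<le> n \<Longrightarrow> z \<in> E \<Longrightarrow> (f ^^ n) z \<in> E \<Longrightarrow>
      e * real n \<le> \<bar>fst ((f ^^ n) z) - fst z\<bar>"
proof -
  obtain m where m: "\<And>n z. m \<le> n \<Longrightarrow> z \<in> E \<Longrightarrow> (f ^^ n) z \<in> E \<Longrightarrow>
      (fst ((f ^^ n) z) - fst z) / real n \<notin> {x. \<bar>x\<bar> \<le> 1 / real (Suc m)}"
  proof (rule rot_set_avoid [of "\<lambda>e. {x. \<bar>x\<bar> \<le> e}" f E])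
    fix l r X
    assume r: "strict_mono (r :: nat \<Rightarrow> nat)" and X: "\<And>k. X k \<in> {x. \<bar>x\<bar> \<le> 1 / real (Suc (r k))}"
      and l: "(\<lambda>k. ereal (X k)) \<longlonglongrightarrow> l"
    have lim: "(\<lambda>n. ereal (1 / real (Suc (r n)))) \<longlonglongrightarrow> 0"
      using LIMSEQ_subseq_LIMSEQ [OF tendsto_ereal_inverse_Suc r] by (simp add: o_def)
    have "l \<le> 0"
      by (rule LIMSEQ_le [OF l lim]) (use X in \<open>auto simp: abs_le_iff\<close>)
    moreover have "- l \<le> 0"
      by (rule LIMSEQ_le [OF tendsto_uminus_ereal [OF l] lim]) (use X in \<open>auto simp: abs_le_iff\<close>)
    ultimately have "l = 0" by (metis antisym ereal_uminus_le_0_iff)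
    then show "l \<notin> rot_set f E" using assms by force
  qed blast
  show ?thesis
  proof (rule that [of "1 / real (Suc m)" "Suc m"])
    fix n z
    assume *: "Suc m \<le> n" "z \<in> E" "(f ^^ n) z \<in> E"
    then show "1 / real (Suc m) * real n \<le> \<bar>fst ((f ^^ n) z) - fst z\<bar>"
      using m [of n z] by (simp add: not_le abs_divide pos_less_divide_eq)
  qed simp
qed

section \<open>Maximal invariant sets and invariant half-planes\<close>

lemma Theta_iff:
  "x \<in> Theta f g E \<longleftrightarrow> (\<forall>n. (f ^^ n) x \<in> E \<and> (g ^^ n) x \<in> E)"
proof
  assume x: "x \<in> Theta f g E"
  show "\<forall>n. (f ^^ n) x \<in> E \<and> (g ^^ n) x \<in> E"
  proof
    fix n
    have "ipow f g (int n) x \<in> E" "ipow f g (- int n) x \<in> E"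
      using x by (auto simp: Theta_def)
    then show "(f ^^ n) x \<in> E \<and> (g ^^ n) x \<in> E"
      by (cases "n = 0") (auto simp: ipow_def)
  qed
next
  assume "\<forall>n. (f ^^ n) x \<in> E \<and> (g ^^ n) x \<in> E"
  then show "x \<in> Theta f g E"
    unfolding Theta_def ipow_def by (auto intro: spec [of _ "0::nat"] dest: spec [of _ "0::nat"])
qed

text \<open>The preimage of the closed upper half-plane is connected and misses the line. The
  witness \<open>x\<close> puts it above the line, which excludes that \<open>f\<close> exchanges
  the two sides.\<close>

lemma hline_image_below_imp_lower_half:
  assumes homeo: "homeomorphism UNIV UNIV f g" and "f ` hline c \<subseteq> Uminus c"
    and x: "c \<le> snd x" "c \<le> snd (f x)" and z: "snd z \<le> c"
  shows "snd (f z) < c"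
proof (rule ccontr)
  assume contra: "\<not> snd (f z) < c"
  let ?U = "{z :: real \<times> real. c \<le> snd z}"
  have fg: "f (g w) = w" "g (f w) = w" for w
    using homeo by (simp_all only: homeomorphism_def UNIV_I)
  have "convex ?U"
    using convex_halfspace_ge [of c "(0, 1) :: real \<times> real"] by (simp add: inner_prod_def)
  then have "connected (snd ` g ` ?U)"
    using homeo unfolding homeomorphism_def
    by (intro connected_continuous_image continuous_intros convex_connected)
      (auto intro: continuous_on_subset)
  moreover have "y \<in> g ` ?U" if "c \<le> snd (f y)" for y
    using that fg(2) [of y] by (intro image_eqI [of _ g "f y"]) auto
  then have "snd x \<in> snd ` g ` ?U" "snd z \<in> snd ` g ` ?U"
    using x(2) contra by auto
  ultimately have "c \<in> snd ` g ` ?U"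
    using x z connectedD_interval by blast
  then obtain w where "c \<le> snd w" "snd (g w) = c" by auto
  then show False
    using assms(2) fg(1) [of w] by (force simp: hline_def Uminus_def)
qed

section \<open>Lifts of annulus homeomorphisms: iterates, periodicity and compactness\<close>

locale annulus_lift =
  fixes f g :: "real \<times> real \<Rightarrow> real \<times> real"
  assumes homeo: "homeomorphism UNIV UNIV f g"
    and comm: "\<And>z. f (Tshift z) = Tshift (f z)"
begin

lemma inverse_simps [simp]: "f (g z) = z" "g (f z) = z"
  using homeo by (simp_all only: homeomorphism_def UNIV_I)

lemma funpow_inverse [simp]: "(f ^^ n) ((g ^^ n) z) = z" "(g ^^ n) ((f ^^ n) z) = z"
  by (induction n arbitrary: z) (simp_all add: funpow_swap1)

lemma funpow_cancel:
  assumes "n \<le> m"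
  shows "(f ^^ n) ((g ^^ m) z) = (g ^^ (m - n)) z" "(g ^^ n) ((f ^^ m) z) = (f ^^ (m - n)) z"
    "(f ^^ m) ((g ^^ n) z) = (f ^^ (m - n)) z" "(g ^^ m) ((f ^^ n) z) = (g ^^ (m - n)) z"
proof -
  obtain k where m: "m = n + k" "m = k + n"
    using assms by (metis add.commute le_Suc_ex)
  show "(f ^^ n) ((g ^^ m) z) = (g ^^ (m - n)) z" "(g ^^ n) ((f ^^ m) z) = (f ^^ (m - n)) z"
    unfolding m(1) by (simp_all add: funpow_add)
  show "(f ^^ m) ((g ^^ n) z) = (f ^^ (m - n)) z" "(g ^^ m) ((f ^^ n) z) = (g ^^ (m - n)) z"
    unfolding m(2) by (simp_all add: funpow_add)
qed

lemma funpow_commute: "(g ^^ n) ((f ^^ m) z) = (f ^^ m) ((g ^^ n) z)"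
proof -
  have "(f ^^ m) ((f ^^ n) ((g ^^ n) z)) = (f ^^ n) ((f ^^ m) ((g ^^ n) z))"
    by (metis add.commute comp_apply funpow_add)
  then show ?thesis by simp
qed

lemma continuous_on_funpow: "continuous_on S (f ^^ n)" "continuous_on S (g ^^ n)"
proof -
  have "continuous_on UNIV f" "continuous_on UNIV g"
    using homeo by (auto simp: homeomorphism_def)
  then have "continuous_on UNIV (f ^^ n)" "continuous_on UNIV (g ^^ n)"
    by (induction n) (auto simp: o_def intro: continuous_on_compose2)
  then show "continuous_on S (f ^^ n)" "continuous_on S (g ^^ n)"
    using continuous_on_subset by blast+
qed

lemma tendsto_funpow:
  assumes "X \<longlonglongrightarrow> x"
  shows "(\<lambda>k. (f ^^ n) (X k)) \<longlonglongrightarrow> (f ^^ n) x" "(\<lambda>k. (g ^^ n) (X k)) \<longlonglongrightarrow> (g ^^ n) x"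
  by (rule continuous_on_tendsto_compose [OF continuous_on_funpow(1) [of UNIV] assms]; simp)
    (rule continuous_on_tendsto_compose [OF continuous_on_funpow(2) [of UNIV] assms]; simp)

lemma shift: "f (z + (of_int k, 0)) = f z + (of_int k, 0)"
proof -
  have nat: "f (z + (real n, 0)) = f z + (real n, 0)" for z n
  proof (induction n)
    case (Suc n)
    have "f (z + (real (Suc n), 0)) = f (Tshift (z + (real n, 0)))"
      by (simp add: Tshift_def prod_eq_iff plus_prod_def algebra_simps)
    then show ?case
      by (simp add: comm Suc) (simp add: Tshift_def prod_eq_iff plus_prod_def)
  qed (simp flip: zero_prod_def)
  show ?thesis
  proof (cases k)
    case (nonneg n)
    then show ?thesis using nat by simp
  next
    case (neg n)
    have "f (z - (real (Suc n), 0) + (real (Suc n), 0)) = f (z - (real (Suc n), 0)) + (real (Suc n), 0)"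
      by (rule nat)
    moreover have "z + (of_int k, 0) = z - (real (Suc n), 0)" 
        "f z + (of_int k, 0) = f z - (real (Suc n), 0)"
      using neg by (auto simp: prod_eq_iff)
    ultimately show ?thesis by (simp only: diff_add_cancel add_diff_cancel_right')
  qed
qed

lemma shift_inverse: "g (z + (of_int k, 0)) = g z + (of_int k, 0)"
  by (metis inverse_simps shift)

lemma shift_funpow:
  "(f ^^ n) (z + (of_int k, 0)) = (f ^^ n) z + (of_int k, 0)"
  "(g ^^ n) (z + (of_int k, 0)) = (g ^^ n) z + (of_int k, 0)"
  by (induction n) (auto simp: shift shift_inverse)

lemma fundamental_strip:
  fixes z :: "real \<times> real"
  obtains k :: int where "fst (z + (of_int k, 0)) \<in> {0..1}" "snd (z + (of_int k, 0)) = snd z"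
proof (rule that [of "- \<lfloor>fst z\<rfloor>"])
  show "fst (z + (of_int (- \<lfloor>fst z\<rfloor>), 0)) \<in> {0..1}"
    by (simp add: algebra_simps) linarith
qed simp

text \<open>By periodicity all values on the band are already taken on a compact rectangle of width
  one.\<close>

lemma periodic_bounded_on_band:
  fixes \<phi> :: "real \<times> real \<Rightarrow> real"
  assumes "continuous_on UNIV \<phi>" and per: "\<And>z k. \<phi> (z + (of_int k, 0)) = \<phi> z"
  obtains M where "\<And>z. z \<in> band a b \<Longrightarrow> \<bar>\<phi> z\<bar> \<le> M"
proof -
  have "compact (\<phi> ` ({0..1} \<times> {a..b}))"
    using assms(1) by (intro compact_continuous_image compact_Times) (auto intro: continuous_on_subset)
  then obtain M where M: "\<And>x. x \<in> \<phi> ` ({0..1} \<times> {a..b}) \<Longrightarrow> \<bar>x\<bar> \<le> M"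
    using compact_imp_bounded bounded_iff by (metis real_norm_def)
  show ?thesis
  proof (rule that)
    fix z assume z: "z \<in> band a b"
    obtain k where "fst (z + (of_int k, 0)) \<in> {0..1}" "snd (z + (of_int k, 0)) = snd z"
      by (rule fundamental_strip)
    with z have "z + (of_int k, 0) \<in> {0..1} \<times> {a..b}"
      by (auto simp: band_def mem_Times_iff)
    then show "\<bar>\<phi> z\<bar> \<le> M"
      using M per by (metis image_eqI)
  qed
qed

text \<open>This replaces limit sets of orbits that drift off horizontally: the points are
  translated back into a compact rectangle, which leaves their displacements unchanged. Since every
  fixed iterate eventually lies in the closed band, the whole orbit of the limit does too.\<close>

lemma limit_in_Theta:
  fixes z :: "nat \<Rightarrow> real \<times> real"
  assumes z: "\<And>k. z k \<in> band a b"
    and ev: "\<And>l. \<forall>\<^sub>F k in sequentially. (f ^^ l) (z k) \<in> band a b \<and> (g ^^ l) (z k) \<in> band a b"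
  obtains \<theta> r where "\<theta> \<in> Theta f g (band a b)" "strict_mono (r :: nat \<Rightarrow> nat)"
    "\<And>n. (\<lambda>k. fst ((f ^^ n) (z (r k))) - fst (z (r k))) \<longlonglongrightarrow> fst ((f ^^ n) \<theta>) - fst \<theta>"
proof -
  have "\<exists>j :: int. z k + (of_int j, 0) \<in> {0..1} \<times> {a..b}" for k
    by (rule fundamental_strip [of "z k"]) (use z [of k] in \<open>auto simp: band_def mem_Times_iff intro!: exI\<close>)
  then obtain j :: "nat \<Rightarrow> int" where j: "\<And>k. z k + (of_int (j k), 0) \<in> {0..1} \<times> {a..b}"
    by metis
  define y where "y k = z k + (of_int (j k), 0)" for k
  have "compact ({0..1::real} \<times> {a..b})"
    by (intro compact_Times compact_Icc)
  then have "\<exists>\<theta>\<in>{0..1} \<times> {a..b}. \<exists>r :: nat \<Rightarrow> nat. strict_mono r \<and> (y \<circ> r) \<longlonglongrightarrow> \<theta>"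
    unfolding compact_def by (elim allE [of _ y] impE) (use j in \<open>auto simp: y_def\<close>)
  then obtain \<theta> r where r: "strict_mono (r :: nat \<Rightarrow> nat)" "(\<lambda>k. y (r k)) \<longlonglongrightarrow> \<theta>"
    unfolding o_def by blast
  have closed: "closed (band a b)"
    unfolding band_def by (intro closed_Collect_conj closed_Collect_le continuous_intros)
  have "(f ^^ l) \<theta> \<in> band a b" "(g ^^ l) \<theta> \<in> band a b" for l
  proof -
    have e: "\<forall>\<^sub>F k in sequentially. (f ^^ l) (y (r k)) \<in> band a b \<and> (g ^^ l) (y (r k)) \<in> band a b"
      using eventually_subseq [OF r(1) ev [of l]]
      by eventually_elim (simp add: y_def shift_funpow band_def)
    show "(f ^^ l) \<theta> \<in> band a b"
      by (rule Lim_in_closed_set [OF closed _ _ tendsto_funpow(1) [OF r(2)]])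
        (use e in \<open>auto elim: eventually_mono\<close>)
    show "(g ^^ l) \<theta> \<in> band a b"
      by (rule Lim_in_closed_set [OF closed _ _ tendsto_funpow(2) [OF r(2)]])
        (use e in \<open>auto elim: eventually_mono\<close>)
  qed
  then have "\<theta> \<in> Theta f g (band a b)"
    by (simp add: Theta_iff)
  moreover have "(\<lambda>k. fst ((f ^^ n) (z (r k))) - fst (z (r k))) \<longlonglongrightarrow> fst ((f ^^ n) \<theta>) - fst \<theta>" for n
  proof -
    have "(\<lambda>k. fst ((f ^^ n) (y (r k))) - fst (y (r k))) \<longlonglongrightarrow> fst ((f ^^ n) \<theta>) - fst \<theta>"
      by (intro tendsto_intros tendsto_funpow r(2))
    then show ?thesis
      by (simp add: y_def shift_funpow)
  qed
  ultimately show ?thesis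
    using that r(1) by blast
qed

lemma Theta_funpow:
  assumes "x \<in> Theta f g E"
  shows "(f ^^ n) x \<in> Theta f g E" "(g ^^ n) x \<in> Theta f g E"
proof -
  have x: "(f ^^ k) x \<in> E" "(g ^^ k) x \<in> E" for k
    using assms by (auto simp: Theta_iff)
  have "(f ^^ k) ((g ^^ n) x) \<in> E" "(g ^^ k) ((f ^^ n) x) \<in> E" for k
    using x by (cases "k \<le> n"; simp add: funpow_cancel)+
  moreover have "(f ^^ k) ((f ^^ n) x) \<in> E" "(g ^^ k) ((g ^^ n) x) \<in> E" for k
    using x [of "k + n"] by (simp_all add: funpow_add)
  ultimately show "(f ^^ n) x \<in> Theta f g E" "(g ^^ n) x \<in> Theta f g E"
    by (auto simp: Theta_iff)
qed

end

section \<open>Bands bounded by lines that are pushed downwards\<close>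

text \<open>\<open>down\<close> is the half-plane form of (H1): it also says on which side the
  points below a line end up.\<close>

locale trapping_bands = annulus_lift +
  fixes c0 c1 c2 :: real
  assumes order: "c2 < c1" "c1 < c0"
    and down: "\<And>c z. c \<in> {c0, c1, c2} \<Longrightarrow> snd z \<le> c \<Longrightarrow> snd (f z) < c"
begin

lemma up: "c \<in> {c0, c1, c2} \<Longrightarrow> c \<le> snd z \<Longrightarrow> c < snd (g z)"
  using down [of c "g z"] by fastforce

lemma down_funpow:
  assumes c: "c \<in> {c0, c1, c2}"
  shows "snd z \<le> c \<Longrightarrow> snd ((f ^^ n) z) \<le> c" "snd z < c \<Longrightarrow> snd ((f ^^ n) z) < c"
proof -
  show "snd z \<le> c \<Longrightarrow> snd ((f ^^ n) z) \<le> c"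
    by (rule funpow_invariant [where P = "\<lambda>z. snd z \<le> c"]) (rule less_imp_le [OF down [OF c]])
  show "snd z < c \<Longrightarrow> snd ((f ^^ n) z) < c"
    by (rule funpow_invariant [where P = "\<lambda>z. snd z < c"]) (rule down [OF c less_imp_le])
qed

lemma up_funpow:
  assumes c: "c \<in> {c0, c1, c2}"
  shows "c \<le> snd z \<Longrightarrow> c \<le> snd ((g ^^ n) z)" "c < snd z \<Longrightarrow> c < snd ((g ^^ n) z)"
proof -
  show "c \<le> snd z \<Longrightarrow> c \<le> snd ((g ^^ n) z)"
    by (rule funpow_invariant [where P = "\<lambda>z. c \<le> snd z"]) (rule less_imp_le [OF up [OF c]])
  show "c < snd z \<Longrightarrow> c < snd ((g ^^ n) z)"
    by (rule funpow_invariant [where P = "\<lambda>z. c < snd z"]) (rule up [OF c less_imp_le])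
qed

text \<open>A point on the lower boundary leaves the band under \<open>f\<close>, and one on the
  upper boundary leaves it under \<open>g\<close>.\<close>

lemma Theta_interior:
  assumes "x \<in> Theta f g (band b a)" "a \<in> {c0, c1, c2}" "b \<in> {c0, c1, c2}"
  shows "b < snd x" "snd x < a"
proof -
  have *: "f x \<in> band b a" "g x \<in> band b a"
    using assms(1) by (auto simp: Theta_iff dest: spec [of _ "1::nat"])
  show "b < snd x"
    using * down [OF assms(3), of x] by (force simp: band_def)
  show "snd x < a"
    using * up [OF assms(2), of x] by (force simp: band_def)
qed

text \<open>If \<open>0\<close> is not in the rotation set, long displacements cannot change sign along the orbit of
  \<open>w\<close>; its limit points in the two bands force opposite signs.\<close>

lemma connecting_orbit_imp_zero_in_rot_set:
  assumes w: "w \<in> Theta f g (band c1 c0 \<union> band c2 c1)" "snd w \<le> c1" "c1 \<le> snd (g w)"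
    and rot0: "rot_set f (Theta f g (band c1 c0)) \<subseteq> {0<..<\<infinity>}"
    and rot1: "rot_set f (Theta f g (band c2 c1)) \<subseteq> {-\<infinity><..<0}"
  shows "0 \<in> rot_set f (Theta f g (band c1 c0 \<union> band c2 c1))"
proof (rule ccontr)
  let ?A = "band c1 c0 \<union> band c2 c1"
  assume "0 \<notin> rot_set f (Theta f g ?A)"
  then obtain e m where "e > 0" and m: "\<And>n z. m \<le> n \<Longrightarrow> z \<in> Theta f g ?A \<Longrightarrow>
      (f ^^ n) z \<in> Theta f g ?A \<Longrightarrow> e * real n \<le> \<bar>fst ((f ^^ n) z) - fst z\<bar>"
    using rot_set_nonzero by blast
  obtain e0 m0 where "e0 > 0" and m0: "\<And>n z. m0 \<le> n \<Longrightarrow> z \<in> Theta f g (band c1 c0) \<Longrightarrow>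
      (f ^^ n) z \<in> Theta f g (band c1 c0) \<Longrightarrow> e0 * real n \<le> fst ((f ^^ n) z) - fst z"
    using rot_set_pos [OF rot0] by blast
  obtain e1 m1 where "e1 > 0" and m1: "\<And>n z. m1 \<le> n \<Longrightarrow> z \<in> Theta f g (band c2 c1) \<Longrightarrow>
      (f ^^ n) z \<in> Theta f g (band c2 c1) \<Longrightarrow> fst ((f ^^ n) z) - fst z \<le> - (e1 * real n)"
    using rot_set_neg [OF rot1] by blast
  have "continuous_on UNIV (\<lambda>z. fst (f z) - fst z)"
    using homeo by (auto simp: homeomorphism_def intro!: continuous_intros)
  then obtain M where M: "\<And>z. z \<in> band c2 c0 \<Longrightarrow> \<bar>fst (f z) - fst z\<bar> \<le> M"
    using periodic_bounded_on_band [of "\<lambda>z. fst (f z) - fst z" c2 c0] by (auto simp: shift)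
  obtain n0 :: nat where n0: "M / e < real n0"
    using reals_Archimedean2 by blast
  \<comment> \<open>\<open>n\<close> exceeds all thresholds and satisfies \<open>M < e * n\<close>;
    it is positive, so that the drifts \<open>e0 * n\<close> and \<open>e1 * n\<close> are
    strict.\<close>
  define n where "n = Max {m, m0, m1, n0, 1}"
  have n: "m \<le> n" "m0 \<le> n" "m1 \<le> n" "n0 \<le> n" "0 < n"
    unfolding n_def by (auto simp: Max_ge_iff)
  have "M / e < real n"
    using n0 n(4) by linarith
  then have Mn: "M < e * real n"
    using \<open>e > 0\<close> by (simp add: pos_divide_less_eq mult.commute)
  define v where "v z = fst ((f ^^ n) z) - fst z" for z
  have M': "\<bar>fst (f z) - fst z\<bar> \<le> M" if "z \<in> Theta f g ?A" for z
  proof -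
    have "z \<in> ?A" using that by (simp add: Theta_def)
    then show ?thesis using order by (intro M) (auto simp: band_def)
  qed
  \<comment> \<open>Both displacements have size at least \<open>e * n\<close>, but they differ by
    at most \<open>2 * M < 2 * e * n\<close>, so they cannot have opposite signs.\<close>
  have step: "v (f z) > 0 \<longleftrightarrow> v z > 0" if z: "z \<in> Theta f g ?A" for z
  proof -
    have fz: "f z \<in> Theta f g ?A" using Theta_funpow(1) [OF z, of 1] by simp
    have "e * real n \<le> \<bar>v z\<bar>" "e * real n \<le> \<bar>v (f z)\<bar>"
      unfolding v_def using m [OF n(1)] Theta_funpow(1) z fz by blast+
    moreover have "\<bar>v (f z) - v z\<bar> \<le> M + M"
      using M' [OF z] M' [OF Theta_funpow(1) [OF z, of n]] by (simp add: v_def funpow_swap1)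
    moreover have "M \<ge> 0" using M' [OF z] by linarith
    ultimately show ?thesis using Mn by (smt (verit))
  qed
  have wf: "v ((f ^^ k) w) > 0 \<longleftrightarrow> v w > 0" for k
    by (induction k) (auto simp: step Theta_funpow(1) [OF w(1)])
  have wg: "v ((g ^^ k) w) > 0 \<longleftrightarrow> v w > 0" for k
  proof (induction k)
    case (Suc k)
    then show ?case
      using step [of "(g ^^ Suc k) w"] Theta_funpow(2) [OF w(1), of "Suc k"] by simp
  qed auto
  have fw: "(f ^^ k) w \<in> band c2 c1" for k
    using down_funpow(1) [OF _ w(2), of k] w(1) order by (force simp: Theta_iff band_def)
  \<comment> \<open>The upper half of the orbit begins at \<open>g w\<close>, since \<open>w\<close>
    itself is on or below \<Gamma>1.\<close>
  have gw: "(g ^^ Suc k) w \<in> band c1 c0" for k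
  proof -
    have "c1 \<le> snd ((g ^^ Suc k) w)"
      using up_funpow(1) [OF _ w(3), of k] by (simp add: funpow_swap1)
    moreover have "(g ^^ Suc k) w \<in> ?A"
      using w(1) unfolding Theta_iff by blast
    ultimately show ?thesis
      using order by (auto simp: band_def)
  qed
  show False
  \<comment> \<open>A positive sign passes to a forward limit in the lower band, where the drift is
    to the left; otherwise a backward limit in the upper band contradicts the drift to the
    right.\<close>
  proof (cases "v w > 0")
    case True
    obtain \<theta> r where th: "\<theta> \<in> Theta f g (band c2 c1)" "strict_mono (r :: nat \<Rightarrow> nat)"
      "\<And>n. (\<lambda>k. fst ((f ^^ n) ((f ^^ r k) w)) - fst ((f ^^ r k) w)) \<longlonglongrightarrow> fst ((f ^^ n) \<theta>) - fst \<theta>"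
    proof (rule limit_in_Theta [of "\<lambda>k. (f ^^ k) w"])
      fix l
      have "(f ^^ l) ((f ^^ k) w) \<in> band c2 c1 \<and> (g ^^ l) ((f ^^ k) w) \<in> band c2 c1" if "l \<le> k" for k
        using fw [of "l + k"] fw [of "k - l"] that by (simp add: funpow_cancel funpow_add)
      then show "\<forall>\<^sub>F k in sequentially.
          (f ^^ l) ((f ^^ k) w) \<in> band c2 c1 \<and> (g ^^ l) ((f ^^ k) w) \<in> band c2 c1"
        by (rule eventually_sequentiallyI)
    qed (use fw in auto)
    have "0 \<le> fst ((f ^^ n) \<theta>) - fst \<theta>"
      by (rule LIMSEQ_le_const [OF th(3)]) (use wf True in \<open>auto simp: v_def intro: less_imp_le\<close>)
    moreover have "fst ((f ^^ n) \<theta>) - fst \<theta> \<le> - (e1 * real n)"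
      using m1 [OF n(3) th(1) Theta_funpow(1) [OF th(1)]] .
    moreover have "0 < e1 * real n"
      using \<open>e1 > 0\<close> n(5) by simp
    ultimately show False by linarith
  next
    case False
    obtain \<theta> r where th: "\<theta> \<in> Theta f g (band c1 c0)" "strict_mono (r :: nat \<Rightarrow> nat)"
      "\<And>n. (\<lambda>k. fst ((f ^^ n) ((g ^^ Suc (r k)) w)) - fst ((g ^^ Suc (r k)) w)) \<longlonglongrightarrow> fst ((f ^^ n) \<theta>) - fst \<theta>"
    proof (rule limit_in_Theta [of "\<lambda>k. (g ^^ Suc k) w"])
      fix l
      have "(f ^^ l) ((g ^^ Suc k) w) \<in> band c1 c0 \<and> (g ^^ l) ((g ^^ Suc k) w) \<in> band c1 c0" if "l \<le> k" for k
      proof -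
        have "(g ^^ l) ((g ^^ Suc k) w) = (g ^^ Suc (l + k)) w"
          by (metis add_Suc_right comp_apply funpow_add)
        moreover have "(f ^^ l) ((g ^^ Suc k) w) = (g ^^ Suc (k - l)) w"
          using that funpow_cancel(1) [of l "Suc k" w] by (simp add: Suc_diff_le)
        ultimately show ?thesis using gw by metis
      qed
      then show "\<forall>\<^sub>F k in sequentially.
          (f ^^ l) ((g ^^ Suc k) w) \<in> band c1 c0 \<and> (g ^^ l) ((g ^^ Suc k) w) \<in> band c1 c0"
        by (rule eventually_sequentiallyI)
    qed (use gw in auto)
    have "v ((g ^^ k) w) \<le> 0" for k
      using False wg [of k] by linarith
    then have "fst ((f ^^ n) \<theta>) - fst \<theta> \<le> 0"
      unfolding v_def by (intro LIMSEQ_le_const2 [OF th(3)]) blast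
    moreover have "e0 * real n \<le> fst ((f ^^ n) \<theta>) - fst \<theta>"
      using m0 [OF n(2) th(1) Theta_funpow(1) [OF th(1)]] .
    moreover have "0 < e0 * real n"
      using \<open>e0 > 0\<close> n(5) by simp
    ultimately show False by linarith
  qed
qed

section \<open>Existence of an orbit from the upper band to the lower one\<close>

text \<open>If no \<open>n\<close> worked, a nested family of nonempty compact sets would have a
  common point, whose orbit crosses \<Gamma>1 and stays between \<Gamma>2 and \<Gamma>0
  forever.\<close>

lemma no_connection_uniform:
  assumes no: "\<And>w. w \<in> Theta f g (band c1 c0 \<union> band c2 c1) \<Longrightarrow> snd w \<le> c1 \<Longrightarrow> snd (g w) < c1"
  obtains n where "\<And>w. snd w \<le> c1 \<Longrightarrow> c1 \<le> snd (g w) \<Longrightarrow> snd ((g ^^ n) w) \<le> c0 \<Longrightarrow>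
      snd ((f ^^ n) w) < c2"
proof (rule ccontr)
  assume contra: "\<not> thesis"
  have ex: "\<exists>w. snd w \<le> c1 \<and> c1 \<le> snd (g w) \<and> snd ((g ^^ n) w) \<le> c0 \<and> c2 \<le> snd ((f ^^ n) w)" for n
    using contra that by (meson not_le)
  \<comment> \<open>The bounds at time \<open>Suc n\<close> imply those at all smaller times,
    because \<open>g\<close> keeps points above \<Gamma>2 and \<open>f\<close> keeps points below
    \<Gamma>0; hence the sets are nested.\<close>
  define F where "F n = {w. w \<in> {0..1} \<times> {c2..c1} \<and> c1 \<le> snd (g w) \<and>
      snd ((g ^^ Suc n) w) \<le> c0 \<and> c2 \<le> snd ((f ^^ Suc n) w)}" for n
  have up': "c2 \<le> snd w" if "c2 \<le> snd ((f ^^ n) w)" for n w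
    using that down_funpow(2) [of c2 w n] by force
  have "\<Inter> (range F) \<noteq> {}"
  proof (rule compact_nest)
    fix n
    have "closed {w. c1 \<le> snd (g w) \<and> snd ((g ^^ Suc n) w) \<le> c0 \<and> c2 \<le> snd ((f ^^ Suc n) w)}"
      using continuous_on_funpow(1) [of UNIV "Suc n"] continuous_on_funpow(2) [of UNIV "Suc n"]
        continuous_on_funpow(2) [of UNIV 1]
      by (intro closed_Collect_conj closed_Collect_le continuous_intros) auto
    moreover have "F n = ({0..1} \<times> {c2..c1}) \<inter>
        {w. c1 \<le> snd (g w) \<and> snd ((g ^^ Suc n) w) \<le> c0 \<and> c2 \<le> snd ((f ^^ Suc n) w)}"
      unfolding F_def by blast
    ultimately show "compact (F n)"
      by (simp only: compact_Int_closed compact_Times compact_Icc)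
    obtain w where w: "snd w \<le> c1" "c1 \<le> snd (g w)" "snd ((g ^^ Suc n) w) \<le> c0" "c2 \<le> snd ((f ^^ Suc n) w)"
      using ex [of "Suc n"] by blast
    obtain k where k: "fst (w + (of_int k, 0)) \<in> {0..1}" "snd (w + (of_int k, 0)) = snd w"
      by (rule fundamental_strip)
    have "w + (of_int k, 0) \<in> F n"
      unfolding F_def mem_Collect_eq shift_funpow shift_inverse mem_Times_iff
      using w k up' [of "Suc n" w] by simp
    then show "F n \<noteq> {}" by blast
  next
    fix m n :: nat
    assume "m \<le> n"
    show "F n \<subseteq> F m"
    proof
      fix w assume w: "w \<in> F n"
      have "(f ^^ Suc m) w = (g ^^ (n - m)) ((f ^^ Suc n) w)"
        "(g ^^ Suc m) w = (f ^^ (n - m)) ((g ^^ Suc n) w)"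
        using \<open>m \<le> n\<close> funpow_cancel(1,2) [of "n - m" "Suc n" w] by (simp_all add: Suc_diff_le)
      then show "w \<in> F m"
        using w up_funpow(1) [of c2 "(f ^^ Suc n) w" "n - m"] down_funpow(1) [of c0 "(g ^^ Suc n) w" "n - m"]
        unfolding F_def by simp
    qed
  qed
  then obtain w where w: "\<And>n. w \<in> F n" by blast
  have w1: "snd w \<le> c1" "c2 \<le> snd w" "c1 \<le> snd (g w)"
    using w [of 0] unfolding F_def by auto
  have "(f ^^ n) w \<in> band c2 c1" for n
  proof (cases n)
    case 0
    then show ?thesis using w1 by (simp add: band_def)
  next
    case (Suc m)
    then show ?thesis
      using w [of m] down_funpow(1) [OF _ w1(1), of n] unfolding F_def band_def by blast
  qed
  moreover have "(g ^^ n) w \<in> band c1 c0 \<union> band c2 c1" for n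
  proof (cases n)
    case 0
    then show ?thesis using w1 by (simp add: band_def)
  next
    case (Suc m)
    have "c1 \<le> snd ((g ^^ Suc m) w)"
      using up_funpow(1) [OF _ w1(3), of m] by (simp add: funpow_swap1)
    then show ?thesis
      using w [of m] Suc unfolding F_def band_def by blast
  qed
  ultimately have "w \<in> Theta f g (band c1 c0 \<union> band c2 c1)"
    unfolding Theta_iff by blast
  then show False
    using no [of w] w1 by linarith
qed

text \<open>An orbit from \<open>a\<close> to \<open>b\<close> would have a first point
  \<open>w\<close> on or below \<Gamma>1. Its \<open>n\<close>-th preimage is still below \<Gamma>0,
  so its \<open>n\<close>-th image is below \<Gamma>2, and then so is that of the later point
  \<open>b\<close>.\<close>

lemma orbits_avoid:
  assumes n: "\<And>w. snd w \<le> c1 \<Longrightarrow> c1 \<le> snd (g w) \<Longrightarrow> snd ((g ^^ n) w) \<le> c0 \<Longrightarrow>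
      snd ((f ^^ n) w) < c2"
    and a: "c1 \<le> snd a" "snd ((g ^^ n) a) \<le> c0"
    and b: "snd b \<le> c1" "c2 \<le> snd ((f ^^ n) b)"
  shows "(f ^^ m) a \<noteq> b"
proof
  assume ab: "(f ^^ m) a = b"
  define j where "j = (LEAST j. snd ((f ^^ j) a) \<le> c1)"
  have j: "snd ((f ^^ j) a) \<le> c1" "j \<le> m"
    unfolding j_def using ab b(1) by (auto intro: LeastI Least_le)
  define w where "w = (f ^^ j) a"
  have "c1 \<le> snd (g w)"
  proof (cases j)
    case 0
    \<comment> \<open>Here \<open>a\<close> lies on \<Gamma>1 itself, and its preimage is strictly
      above.\<close>
    then show ?thesis using up [of c1 a] a(1) by (simp add: w_def)
  next
    case (Suc i)
    then have "\<not> snd ((f ^^ i) a) \<le> c1"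
      using not_less_Least [of i "\<lambda>j. snd ((f ^^ j) a) \<le> c1"] by (simp add: j_def)
    then show ?thesis using Suc by (simp add: w_def)
  qed
  moreover have "snd ((g ^^ n) w) \<le> c0"
  proof -
    have "(g ^^ n) w = (f ^^ j) ((g ^^ n) a)"
      by (simp add: w_def funpow_commute)
    then show ?thesis using down_funpow(1) [OF _ a(2)] by simp
  qed
  ultimately have "snd ((f ^^ n) w) < c2"
    using n j(1) by (simp add: w_def)
  then have "snd ((f ^^ (m - j)) ((f ^^ n) w)) < c2"
    by (rule down_funpow(2) [rotated]) simp
  moreover have "(f ^^ (m - j)) ((f ^^ n) w) = (f ^^ n) b"
  proof -
    have "(f ^^ (m - j + (n + j))) a = (f ^^ (n + m)) a"
      using j(2) by (simp add: ac_simps)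
    then show ?thesis
      unfolding w_def ab [symmetric] by (simp add: funpow_add)
  qed
  ultimately show False using b(2) by simp
qed

lemma connecting_orbit_exists:
  assumes iso: "isotopic_to_id f"
    and th0: "\<theta>0 \<in> Theta f g (band c1 c0)" and th1: "\<theta>1 \<in> Theta f g (band c2 c1)"
    and rot0: "rot_set f (Theta f g (band c1 c0)) \<subseteq> {0<..<\<infinity>}"
    and rot1: "rot_set f (Theta f g (band c2 c1)) \<subseteq> {-\<infinity><..<0}"
  obtains w where "w \<in> Theta f g (band c1 c0 \<union> band c2 c1)" "snd w \<le> c1" "c1 \<le> snd (g w)"
proof (rule ccontr)
  assume contra: "\<not> thesis"
  note witness = that
  have "snd (g w) < c1" if "w \<in> Theta f g (band c1 c0 \<union> band c2 c1)" "snd w \<le> c1" for w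
    using contra witness [OF that] by (meson not_le)
  then obtain n where n: "\<And>w. snd w \<le> c1 \<Longrightarrow> c1 \<le> snd (g w) \<Longrightarrow>
      snd ((g ^^ n) w) \<le> c0 \<Longrightarrow> snd ((f ^^ n) w) < c2"
    using no_connection_uniform by blast
  have th0_orbit: "c1 < snd ((f ^^ k) \<theta>0)" "snd ((g ^^ k) \<theta>0) < c0" for k
    using Theta_interior [OF Theta_funpow(1) [OF th0]] Theta_interior [OF Theta_funpow(2) [OF th0]] by simp_all
  have th1_orbit: "c2 < snd ((f ^^ k) \<theta>1)" "snd ((g ^^ k) \<theta>1) < c1" for k
    using Theta_interior [OF Theta_funpow(1) [OF th1]] Theta_interior [OF Theta_funpow(2) [OF th1]] by simp_all
  have half: "convex (Uplus c)" "convex (Uminus c)" "open (Uplus c)" "open (Uminus c)" for c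
    using convex_halfspace_gt [of c "(0, 1) :: real \<times> real"] convex_halfspace_lt [of "(0, 1) :: real \<times> real" c]
      open_halfspace_gt [of c "(0, 1) :: real \<times> real"] open_halfspace_lt [of "(0, 1) :: real \<times> real" c]
    by (simp_all add: Uplus_def Uminus_def inner_prod_def)
  have cl: "closure (Uplus c) \<subseteq> {z. c \<le> snd z}" "closure (Uminus c) \<subseteq> {z. snd z \<le> c}" for c
    by (rule closure_minimal; force intro!: closed_Collect_le continuous_intros
        simp: Uplus_def Uminus_def)+
  have P: "z \<in> (f ^^ k) ` Uminus c0 \<longleftrightarrow> snd ((g ^^ k) z) < c0" for z k
    by (auto simp: Uminus_def intro!: image_eqI [of _ "f ^^ k" "(g ^^ k) z"])
  have Q: "z \<in> (g ^^ k) ` Uplus c2 \<longleftrightarrow> c2 < snd ((f ^^ k) z)" for z k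
    by (auto simp: Uplus_def intro!: image_eqI [of _ "g ^^ k" "(f ^^ k) z"])
  have pc: "path_connected ((f ^^ k) ` Uminus c0)" "path_connected ((g ^^ k) ` Uplus c2)" for k
    by (intro path_connected_continuous_image continuous_on_funpow convex_imp_path_connected half)+

  \<comment> \<open>The target is an iterate of a point of \<Gamma>1 and hence on or below it, so
    the path has to leave the half-plane above \<Gamma>1 and can be cut there.\<close>
  obtain \<delta> where \<delta>: "path \<delta>" "pathstart \<delta> = \<theta>0"
    "path_image \<delta> \<subseteq> (f ^^ n) ` Uminus c0 \<inter> closure (Uplus c1)" "pathfinish \<delta> \<notin> Uplus c1"
  proof (rule path_to_boundary [OF pc(1) [of n], of \<theta>0 "(f ^^ n) (0, c1)" "Uplus c1"])
    show "\<theta>0 \<in> (f ^^ n) ` Uminus c0" using P th0_orbit by blast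
    show "(f ^^ n) (0, c1) \<in> (f ^^ n) ` Uminus c0" using order by (auto simp: Uminus_def)
    show "\<theta>0 \<in> Uplus c1" using th0_orbit(1) [of 0] by (simp add: Uplus_def)
    show "(f ^^ n) (0, c1) \<notin> Uplus c1" using down_funpow(1) [of c1 "(0, c1)" n] by (simp add: Uplus_def)
  qed (use half in auto)
  obtain \<sigma> where \<sigma>: "path \<sigma>" "pathstart \<sigma> = \<theta>1"
    "path_image \<sigma> \<subseteq> (g ^^ n) ` Uplus c2 \<inter> closure (Uminus c1)" "pathfinish \<sigma> \<notin> Uminus c1"
  proof (rule path_to_boundary [OF pc(2) [of n], of \<theta>1 "(g ^^ n) (0, c1)" "Uminus c1"])
    show "\<theta>1 \<in> (g ^^ n) ` Uplus c2" using Q th1_orbit by blast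
    show "(g ^^ n) (0, c1) \<in> (g ^^ n) ` Uplus c2" using order by (auto simp: Uplus_def)
    show "\<theta>1 \<in> Uminus c1" using th1_orbit(2) [of 0] by (simp add: Uminus_def)
    show "(g ^^ n) (0, c1) \<notin> Uminus c1" using up_funpow(1) [of c1 "(0, c1)" n] by (simp add: Uminus_def)
  qed (use half in auto)
  have \<delta>1: "c1 \<le> snd (\<delta> t)" "snd ((g ^^ n) (\<delta> t)) < c0" if "t \<in> {0..1}" for t
    using \<delta>(3) that cl P unfolding path_image_def by blast+
  have \<sigma>1: "snd (\<sigma> t) \<le> c1" "c2 < snd ((f ^^ n) (\<sigma> t))" if "t \<in> {0..1}" for t
    using \<sigma>(3) that cl Q unfolding path_image_def by blast+
  have disj: "(f ^^ m) (\<delta> t) \<noteq> \<sigma> s" if "t \<in> {0..1}" "s \<in> {0..1}" for m t s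
    using orbits_avoid [OF n] \<delta>1 \<sigma>1 that by (meson less_imp_le)
  \<comment> \<open>The endpoint lies on \<Gamma>1 and its preimage above, so the choice of
    \<open>n\<close> applies; for \<open>\<sigma>\<close> it is used in contrapositive form.\<close>
  have \<delta>_end: "snd ((f ^^ n) (\<delta> 1)) \<le> c2"
  proof -
    have "snd (\<delta> 1) = c1"
      using \<delta>(4) \<delta>1(1) [of 1] by (simp add: pathfinish_def Uplus_def)
    then show ?thesis
      using n [of "\<delta> 1"] up [of c1 "\<delta> 1"] \<delta>1(2) [of 1] by simp
  qed
  have \<sigma>_end: "c0 \<le> snd ((g ^^ n) (\<sigma> 1))"
  proof -
    have "snd (\<sigma> 1) = c1"
      using \<sigma>(4) \<sigma>1(1) [of 1] by (simp add: pathfinish_def Uminus_def)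
    then show ?thesis
      using n [of "\<sigma> 1"] up [of c1 "\<sigma> 1"] \<sigma>1(2) [of 1] by force
  qed

  have cont\<delta>: "continuous_on {0..1} \<delta>" and cont\<sigma>: "continuous_on {0..1} \<sigma>"
    using \<delta>(1) \<sigma>(1) by (auto simp: path_def)
  have cont_comp: "continuous_on {0..1} (\<lambda>t. (f ^^ k) (\<delta> t))" "continuous_on {0..1} (\<lambda>t. (g ^^ k) (\<sigma> t))" for k
    by (rule continuous_on_compose2 [OF continuous_on_funpow(1) [of UNIV] cont\<delta>];
        simp)
      (rule continuous_on_compose2 [OF continuous_on_funpow(2) [of UNIV] cont\<sigma>]; simp)
  have bdd: "\<exists>M. \<forall>t\<in>{0..1}. fst (p t) < M" if "continuous_on {0..1} p" for p :: "real \<Rightarrow> real \<times> real"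
  proof -
    have "compact ((\<lambda>t. fst (p t)) ` {0..1})"
      using that by (intro compact_continuous_image continuous_intros) auto
    then obtain M where "\<And>x. x \<in> (\<lambda>t. fst (p t)) ` {0..1} \<Longrightarrow> norm x \<le> M"
      using compact_imp_bounded bounded_iff by metis
    then have "\<forall>t\<in>{0..1}. fst (p t) < M + 1" by force
    then show ?thesis ..
  qed
  obtain M0 where M0: "\<And>t. t \<in> {0..1} \<Longrightarrow> fst ((f ^^ n) (\<delta> t)) < M0"
    using bdd [OF cont_comp(1)] by blast
  obtain M1 where M1: "\<And>t. t \<in> {0..1} \<Longrightarrow> fst ((g ^^ n) (\<sigma> t)) < M1"
    using bdd [OF cont_comp(2)] by blast
  obtain e0 m0 where "e0 > 0" and m0: "\<And>n z. m0 \<le> n \<Longrightarrow> z \<in> Theta f g (band c1 c0) \<Longrightarrow>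
      (f ^^ n) z \<in> Theta f g (band c1 c0) \<Longrightarrow> e0 * real n \<le> fst ((f ^^ n) z) - fst z"
    using rot_set_pos [OF rot0] by blast
  obtain e1 m1 where "e1 > 0" and m1: "\<And>n z. m1 \<le> n \<Longrightarrow> z \<in> Theta f g (band c2 c1) \<Longrightarrow>
      (f ^^ n) z \<in> Theta f g (band c2 c1) \<Longrightarrow> fst ((f ^^ n) z) - fst z \<le> - (e1 * real n)"
    using rot_set_neg [OF rot1] by blast
  obtain k0 :: nat where k0: "(M1 - fst \<theta>0) / e0 < real k0"
    using reals_Archimedean2 by blast
  obtain k1 :: nat where k1: "(M0 - fst \<theta>1) / e1 < real k1"
    using reals_Archimedean2 by blast
  \<comment> \<open>\<open>N\<close> passes both time thresholds and lets the drift carry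
    \<open>\<theta>0\<close> beyond \<open>M1\<close> forwards and \<open>\<theta>1\<close> beyond
    \<open>M0\<close> backwards; a drift to the left becomes one to the right in backward
    time.\<close>
  define N where "N = m0 + m1 + k0 + k1"
  have far0: "M1 < fst ((f ^^ (N + n)) \<theta>0)"
  proof -
    have "(M1 - fst \<theta>0) / e0 < real (N + n)" using k0 by (simp add: N_def)
    then have "M1 - fst \<theta>0 < e0 * real (N + n)"
      using \<open>e0 > 0\<close> by (simp only: pos_divide_less_eq mult.commute)
    moreover have "e0 * real (N + n) \<le> fst ((f ^^ (N + n)) \<theta>0) - fst \<theta>0"
      by (rule m0) (auto simp: N_def th0 Theta_funpow)
    ultimately show ?thesis by linarith
  qed
  have far1: "M0 < fst ((g ^^ (N + n)) \<theta>1)"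
  proof -
    have "(M0 - fst \<theta>1) / e1 < real (N + n)" using k1 by (simp add: N_def)
    then have "M0 - fst \<theta>1 < e1 * real (N + n)"
      using \<open>e1 > 0\<close> by (simp only: pos_divide_less_eq mult.commute)
    moreover have "fst ((f ^^ (N + n)) ((g ^^ (N + n)) \<theta>1)) - fst ((g ^^ (N + n)) \<theta>1) \<le> - (e1 * real (N + n))"
      by (rule m1) (auto simp: N_def th1 Theta_funpow)
    ultimately show ?thesis by simp
  qed

  define a0 where "a0 = (f ^^ n) \<theta>0"
  define a1 where "a1 = (g ^^ (N + n)) (\<sigma> 1)"
  define b0 where "b0 = (g ^^ (N + n)) \<theta>1"
  define b1 where "b1 = (f ^^ n) (\<delta> 1)"
  have fN: "(f ^^ N) ((f ^^ n) z) = (f ^^ (N + n)) z" "(f ^^ N) ((g ^^ (N + n)) z) = (g ^^ n) z" for z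
    by (simp_all add: funpow_add)
  \<comment> \<open>Choosing \<open>p\<close> inside this preimage keeps both \<open>p\<close> and
    its image under \<open>f^N\<close> above \<Gamma>2.\<close>
  obtain p where p: "path p" "path_image p \<subseteq> (g ^^ N) ` Uplus c2" "pathstart p = a0" "pathfinish p = a1"
  proof -
    have "a0 \<in> (g ^^ N) ` Uplus c2" "a1 \<in> (g ^^ N) ` Uplus c2"
      unfolding Q a0_def a1_def fN using th0_orbit(1) [of "N + n"] \<sigma>_end order by simp_all
    then show ?thesis
      using pc(2) [of N] that unfolding path_connected_def by blast
  qed
  have p_above: "c2 < snd z" "c2 < snd ((f ^^ N) z)" if "z \<in> path_image p" for z
  proof -
    show *: "c2 < snd ((f ^^ N) z)" using p(2) that Q by blast
    show "c2 < snd z" using up_funpow(2) [OF _ *, of N] by simp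
  qed
  \<comment> \<open>The paths move in turn. First \<open>\<beta>\<close> runs to \<open>b1\<close>
    at heights at most \<open>c1\<close> while \<open>\<alpha>\<close> waits at \<open>a0\<close>;
    then \<open>\<alpha>\<close> follows \<open>p\<close> above \<Gamma>2 while
    \<open>\<beta>\<close> waits at \<open>b1\<close>. Thus \<open>\<alpha>\<close> is above
    \<open>\<beta>\<close> before and after \<open>f^N\<close>.\<close>
  define \<alpha> where "\<alpha> = linepath a0 a0 +++ p"
  define \<beta> where "\<beta> = linepath b0 b1 +++ linepath b1 b1"
  have b1_low: "snd b1 \<le> c2" "snd ((f ^^ N) b1) \<le> c2"
    using \<delta>_end down_funpow(1) [of c2 b1 N] by (simp_all add: b1_def)
  have a0_high: "c1 < snd a0" "c1 < snd ((f ^^ N) a0)"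
    using th0_orbit(1) by (simp_all add: a0_def fN)
  have separated: "snd (\<beta> r) < snd (\<alpha> r) \<and> snd ((f ^^ N) (\<beta> r)) < snd ((f ^^ N) (\<alpha> r))" if r: "r \<in> {0..1}" for r
  proof (cases "r \<le> 1/2")
    case True
    have "convex {z :: real \<times> real. snd z \<le> c1}"
      using convex_halfspace_le [of "(0, 1) :: real \<times> real" c1] by (simp add: inner_prod_def)
    moreover have "snd b0 \<le> c1" "snd b1 \<le> c1"
      using th1_orbit(2) [of "N + n"] b1_low order by (simp_all add: b0_def)
    ultimately have "closed_segment b0 b1 \<subseteq> {z. snd z \<le> c1}"
      by (intro closed_segment_subset) auto
    moreover have "\<beta> r \<in> closed_segment b0 b1"
      using True r linepath_in_path [of "2 * r" b0 b1] by (simp add: \<beta>_def joinpaths_def)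
    ultimately have "snd (\<beta> r) \<le> c1" by blast
    moreover have "\<alpha> r = a0"
      using True by (simp add: \<alpha>_def joinpaths_def)
    ultimately show ?thesis
      using a0_high down_funpow(1) [of c1 "\<beta> r" N] by simp
  next
    case False
    then have "\<beta> r = b1" "\<alpha> r = p (2 * r - 1)"
      by (simp_all add: \<alpha>_def \<beta>_def joinpaths_def)
    moreover have "p (2 * r - 1) \<in> path_image p"
      using False r by (auto simp: path_image_def)
    ultimately show ?thesis
      using p_above [of "\<alpha> r"] b1_low by simp
  qed
  show False
  proof (rule isotopy_preserves_turning_side [OF isotopic_to_id_funpow [OF iso, of N] cont_comp(1) [of n] cont_comp(2) [of "N + n"], of \<alpha> \<beta>])
    have "path \<alpha>" "path \<beta>"
      using p by (auto simp: \<alpha>_def \<beta>_def)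
    then show "continuous_on {0..1} \<alpha>" "continuous_on {0..1} \<beta>"
      by (auto simp: path_def)
    have "pathstart \<alpha> = a0" "pathstart \<beta> = b0" "pathfinish \<alpha> = a1" "pathfinish \<beta> = b1"
      using p by (simp_all add: \<alpha>_def \<beta>_def)
    then show "\<alpha> 0 = (f ^^ n) (\<delta> 0)" "\<beta> 0 = (g ^^ (N + n)) (\<sigma> 0)"
        "\<alpha> 1 = (g ^^ (N + n)) (\<sigma> 1)" "\<beta> 1 = (f ^^ n) (\<delta> 1)"
      using \<delta>(2) \<sigma>(2) by (simp_all add: pathstart_def pathfinish_def a0_def a1_def b0_def b1_def)
    have start: "\<delta> 0 = \<theta>0" "\<sigma> 0 = \<theta>1"
      using \<delta>(2) \<sigma>(2) by (simp_all add: pathstart_def)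
    fix t :: real
    assume t: "t \<in> {0..1}"
    show "(f ^^ n) (\<delta> t) \<noteq> (g ^^ (N + n)) (\<sigma> s)" if "s \<in> {0..1}" for s
    proof
      assume "(f ^^ n) (\<delta> t) = (g ^^ (N + n)) (\<sigma> s)"
      then have "(f ^^ (N + n)) ((f ^^ n) (\<delta> t)) = \<sigma> s" by simp
      then have "(f ^^ (N + n + n)) (\<delta> t) = \<sigma> s" by (simp add: funpow_add)
      then show False using disj t that by blast
    qed
    show "snd (\<beta> t) < snd (\<alpha> t)" "snd ((f ^^ N) (\<beta> t)) < snd ((f ^^ N) (\<alpha> t))"
      using separated [OF t] by simp_all
    show "fst ((f ^^ n) (\<delta> t)) < fst ((g ^^ (N + n)) (\<sigma> 0))"
      using M0 [OF t] far1 start by simp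
    \<comment> \<open>Write \<open>g^(N+n)\<close> as \<open>g^(N+2n)\<close> after
      \<open>f^n\<close>: the point \<open>f^n (\<sigma> t)\<close> is above \<Gamma>2 and backward
      iterates stay there. The last inequality is the mirror image at \<Gamma>0.\<close>
    show "snd ((f ^^ n) (\<delta> 1)) < snd ((g ^^ (N + n)) (\<sigma> t))"
      using \<delta>_end up_funpow(2) [OF _ \<sigma>1(2) [OF t], of "N + n + n"]
      by (simp add: funpow_add)
    show "fst ((f ^^ N) ((g ^^ (N + n)) (\<sigma> t))) < fst ((f ^^ N) ((f ^^ n) (\<delta> 0)))"
      using M1 [OF t] far0 start by (simp only: fN)
    show "snd ((f ^^ N) ((f ^^ n) (\<delta> t))) < snd ((f ^^ N) ((g ^^ (N + n)) (\<sigma> 1)))"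
      using \<sigma>_end down_funpow(2) [OF _ \<delta>1(2) [OF t], of "N + n + n"]
      by (simp only: fN) (simp add: funpow_add)
  qed
qed

end

section \<open>From lines moved downwards to half-planes mapped into themselves\<close>

theorem mainTheorem13:
  fixes f g :: "real \<times> real \<Rightarrow> real \<times> real"
    and c0 c1 c2 :: real
  assumes homeo: "homeomorphism UNIV UNIV f g"
    and iso: "isotopic_to_id f"
    and comm: "\<And>z. f (Tshift z) = Tshift (f z)"
    and H1_order: "hline c0 \<subseteq> Uplus c1" "hline c1 \<subseteq> Uplus c2"
    and H1_move: "\<And>j. j \<in> {c0, c1, c2} \<Longrightarrow> f ` hline j \<subseteq> Uminus j"
    and H2: "\<And>n::nat. n \<ge> 1 \<Longrightarrow> (f ^^ n) ` hline c0 \<inter> hline c2 \<noteq> {}"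
    and H3_ne: "Theta f g (band c1 c0) \<noteq> {}" "Theta f g (band c2 c1) \<noteq> {}"
    and H3_rot0: "rot_set f (Theta f g (band c1 c0)) \<subseteq> {0<..<\<infinity>}"
    and H3_rot1: "rot_set f (Theta f g (band c2 c1)) \<subseteq> {-\<infinity><..<0}"
  shows "0 \<in> rot_set f (Theta f g (band c1 c0 \<union> band c2 c1))"
proof -
  interpret annulus_lift f g
    by unfold_locales (use homeo comm in auto)
  have order: "c2 < c1" "c1 < c0"
    using H1_order subsetD [OF H1_order(1), of "(0, c0)"] subsetD [OF H1_order(2), of "(0, c1)"]
    by (simp_all add: hline_def Uplus_def)
  obtain \<theta>0 \<theta>1 where th0: "\<theta>0 \<in> Theta f g (band c1 c0)" and th1: "\<theta>1 \<in> Theta f g (band c2 c1)"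
    using H3_ne by blast
  \<comment> \<open>A point of an invariant band is above the lower boundary line together with its
    image, and so is the witness that fixes the sides for \<Gamma>1 and \<Gamma>2.\<close>
  have band0: "\<theta>0 \<in> band c1 c0" "f \<theta>0 \<in> band c1 c0" and band1: "\<theta>1 \<in> band c2 c1" "f \<theta>1 \<in> band c2 c1"
    using th0 th1 Theta_funpow(1) [of _ _ 1] by (auto simp: Theta_def)
  have down1: "snd (f z) < c1" if "snd z \<le> c1" for z
    using hline_image_below_imp_lower_half [OF homeo H1_move, of c1 \<theta>0 z] that band0 by (simp add: band_def)
  have down2: "snd (f z) < c2" if "snd z \<le> c2" for z
    using hline_image_below_imp_lower_half [OF homeo H1_move, of c2 \<theta>1 z] that band1 by (simp add: band_def)
  have down0: "snd (f z) < c0" if "snd z \<le> c0" for z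
  proof -
    have "continuous_on UNIV (\<lambda>z. snd (f z))"
      using homeo by (auto simp: homeomorphism_def intro!: continuous_intros)
    then obtain M where M: "\<And>z. z \<in> band c1 c0 \<Longrightarrow> \<bar>snd (f z)\<bar> \<le> M"
      using periodic_bounded_on_band [of "\<lambda>z. snd (f z)" c1 c0] by (auto simp: shift)
    \<comment> \<open>For \<Gamma>0 the witness is a preimage of a very high point: it lies above
      \<Gamma>1, and not in the upper band, where images have height at most \<open>M\<close>, so it
      lies above \<Gamma>0.\<close>
    define x where "x = g (0, max c0 (M + 1))"
    have fx: "snd (f x) = max c0 (M + 1)" by (simp add: x_def)
    have "c1 < snd x"
      using down1 [of x] fx order by linarith
    moreover have "x \<notin> band c1 c0"
      using M [of x] fx by force
    ultimately have "c0 \<le> snd x"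
      by (simp add: band_def)
    then show ?thesis
      using hline_image_below_imp_lower_half [OF homeo H1_move, of c0 x z] that fx by simp
  qed
  interpret trapping_bands f g c0 c1 c2
    by unfold_locales (use order down0 down1 down2 in blast)+
  obtain w where "w \<in> Theta f g (band c1 c0 \<union> band c2 c1)" "snd w \<le> c1" "c1 \<le> snd (g w)"
    using connecting_orbit_exists [OF iso th0 th1 H3_rot0 H3_rot1] by blast
  then show ?thesis
    using connecting_orbit_imp_zero_in_rot_set H3_rot0 H3_rot1 by blast
qed

end
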